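(* For a smooth function $f:\mathbb{R}\to\mathbb{R}$ let $\mathcal{M}^1_{6,f}=(\mathbb{R}^6,g^1_{6,f})$, where in coordinates $(x,y,z_1,z_2,\tilde y,\tilde x)$ the non-zero components of the metric are, up to symmetry, $$g^1_{6,f}(\partial_x,\partial_{\tilde x})=g^1_{6,f}(\partial_y,\partial_{\tilde y})=g^1_{6,f}(\partial_{z_1},\partial_{z_1})=g^1_{6,f}(\partial_{z_2},\partial_{z_2})=1,\qquad g^1_{6,f}(\partial_x,\partial_x)=-2(yz_1+f(y)z_2).$$ For $P\in\mathbb{R}^6$ set $$\alpha^1_6(f,P)=\frac{|f'(P)|}{\sqrt{1+(f'(P))^2}},$$ where $f'(P)$ denotes $f'$ evaluated at the $y$-coordinate of $P$. Assume that all functions $f,f_1,f_2$ below have everywhere positive second derivative. Then: \begin{enumerate} \item $\mathcal{M}^1_{6,f}$ is a $0$-curvature homogeneous generalized plane wave manifold. \item If $\mathcal{U}^1(\mathcal{M}^1_{6,f_1},P_1)$ and $\mathcal{U}^1(\mathcal{M}^1_{6,f_2},P_2)$ are isomorphic, then $\alpha^1_6(f_1,P_1)=\alpha^1_6(f_2,P_2)$. \item $\alpha^1_6$ is an isometry invariant of this family which is not of Weyl type: any isometry from a neighborhood of $P_1$ in $\mathcal{M}^1_{6,f_1}$ to a neighborhood of $P_2$ in $\mathcal{M}^1_{6,f_2}$ taking $P_1$ to $P_2$ forces $\alpha^1_6(f_1,P_1)=\alpha^1_6(f_2,P_2)$, and $\alpha^1_6$ is not given on this family by a scalar Weyl invariant.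 \item $\mathcal{M}^1_{6,f}$ is not $1$-curvature homogeneous. \end{enumerate}
   Context: A pseudo-Riemannian manifold $(\mathbb{R}^m,g)$ with Levi-Civita connection $\nabla$ is a generalized plane wave manifold if in the usual coordinates $(x_1,\dots,x_m)$ one has $\nabla_{\partial_{x_i}}\partial_{x_j}=\sum_{k>\max(i,j)}\Gamma_{ij}{}^k(x_1,\dots,x_{k-1})\partial_{x_k}$. Here the coordinates on $\mathbb{R}^6$ are taken in the order $(x,y,z_1,z_2,\tilde y,\tilde x)$. For a pseudo-Riemannian manifold $\mathcal{M}=(M,g)$ and $P\in M$, use the metric to lower indices and regard $\nabla^iR\in\otimes^{4+i}T^*M$. Set $\mathcal{U}^k(\mathcal{M},P):=(T_PM,g_P,R_P,\dots,\nabla^kR_P)$. An isomorphism from $\mathcal{U}^k(\mathcal{M}_1,P)$ to $\mathcal{U}^k(\mathcal{M}_2,Q)$ is a linear isomorphism $\Psi:T_PM_1\to T_QM_2$ with $\Psi^*g_Q=g_P$ and $\Psi^*\nabla^iR_Q=\nabla^iR_P$ for $0\le i\le k$. $\mathcal{M}$ is $k$-curvature homogeneous if for any two points $P,Q\in M$ the models $\mathcal{U}^k(\mathcal{M},P)$ and $\mathcal{U}^k(\mathcal{M},Q)$ are isomorphic. Weyl (scalar) invariants are the scalars formed by using $g^{ij}$ and $g_{ij}$ to fully contract all indices in products of the components of $R$ and its covariant derivatives, and linear combinations of these. *)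

theory Defs
  imports "HOL-Analysis.Analysis"
begin

definition smooth_real :: "(real \<Rightarrow> real) \<Rightarrow> bool" where
  "smooth_real f \<longleftrightarrow> (\<forall>k x. (deriv ^^ k) f differentiable (at x))"

definition partial :: "'n::finite \<Rightarrow> (real^'n \<Rightarrow> real) \<Rightarrow> real^'n \<Rightarrow> real" where
  "partial i F p = deriv (\<lambda>t. F (p + t *\<^sub>R axis i 1)) 0"

text \<open>For open \<open>U\<close> this is \<open>C\<^sup>\<infinity>\<close>: all iterated partial derivatives exist and are (totally)
  differentiable, hence continuous, on \<open>U\<close>.\<close>

definition smooth_on :: "(real^'n::finite) set \<Rightarrow> (real^'n \<Rightarrow> real) \<Rightarrow> bool" where
  "smooth_on U F \<longleftrightarrow> (\<forall>is. \<forall>p\<in>U. foldr partial is F differentiable (at p))"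

definition smooth_map_on :: "(real^'n::finite) set \<Rightarrow> (real^'n \<Rightarrow> real^'n) \<Rightarrow> bool" where
  "smooth_map_on U \<phi> \<longleftrightarrow> (\<forall>i. smooth_on U (\<lambda>p. \<phi> p $ i))"

text \<open>The index type \<open>'n\<close> plays the role of \<open>{1,\<dots>,m}\<close>; each tangent space is identified with
  \<open>real^'n\<close> through the coordinate frame, so \<open>g p $ i $ j\<close> is \<open>g(\<partial>\<^sub>i,\<partial>\<^sub>j)\<close> at \<open>p\<close>.\<close>

type_synonym 'n metric = "real^'n \<Rightarrow> real^'n^'n"

definition pseudo_riemannian :: "'n::finite metric \<Rightarrow> bool" where
  "pseudo_riemannian g \<longleftrightarrow>
     (\<forall>i j. smooth_on UNIV (\<lambda>p. g p $ i $ j)) \<and>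
     (\<forall>p. transpose (g p) = g p \<and> invertible (g p))"

definition metric_form :: "'n::finite metric \<Rightarrow> real^'n \<Rightarrow> real^'n \<Rightarrow> real^'n \<Rightarrow> real" where
  "metric_form g p v w = v \<bullet> (g p *v w)"

text \<open>The Levi-Civita connection:
  \<open>\<nabla>\<^bsub>\<partial>\<^sub>i\<^esub> \<partial>\<^sub>j = (\<Sum>k. christoffel g p i j k *\<^sub>R \<partial>\<^sub>k)\<close>.\<close>

definition christoffel :: "'n::finite metric \<Rightarrow> real^'n \<Rightarrow> 'n \<Rightarrow> 'n \<Rightarrow> 'n \<Rightarrow> real" where
  "christoffel g p i j k =
     1/2 * (\<Sum>l\<in>UNIV. matrix_inv (g p) $ k $ l *
       (partial i (\<lambda>q. g q $ j $ l) p + partial j (\<lambda>q. g q $ i $ l) p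
          - partial l (\<lambda>q. g q $ i $ j) p))"

text \<open>Components of \<open>R(\<partial>\<^sub>i,\<partial>\<^sub>j)\<partial>\<^sub>k\<close> along \<open>\<partial>\<^sub>l\<close>, with the convention
  \<open>R(X,Y) = \<nabla>\<^sub>X \<nabla>\<^sub>Y - \<nabla>\<^sub>Y \<nabla>\<^sub>X - \<nabla>\<^bsub>[X,Y]\<^esub>\<close>.\<close>

definition curvature_op ::
    "'n::finite metric \<Rightarrow> real^'n \<Rightarrow> 'n \<Rightarrow> 'n \<Rightarrow> 'n \<Rightarrow> 'n \<Rightarrow> real" where
  "curvature_op g p i j k l =
     partial i (\<lambda>q. christoffel g q j k l) p - partial j (\<lambda>q. christoffel g q i k l) p
     + (\<Sum>m\<in>UNIV. christoffel g p j k m * christoffel g p i m l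
                   - christoffel g p i k m * christoffel g p j m l)"

definition curvature ::
    "'n::finite metric \<Rightarrow> real^'n \<Rightarrow> 'n \<Rightarrow> 'n \<Rightarrow> 'n \<Rightarrow> 'n \<Rightarrow> real" where
  "curvature g p i j k l = (\<Sum>m\<in>UNIV. curvature_op g p i j k m * g p $ m $ l)"

text \<open>A covariant tensor field of rank \<open>r\<close> is given by its components at index lists of length
  \<open>r\<close>; values at lists of any other length are irrelevant.\<close>

type_synonym 'n tensor_field = "real^'n \<Rightarrow> 'n list \<Rightarrow> real"

text \<open>The index of differentiation is the last one.\<close>

definition cov_deriv :: "'n::finite metric \<Rightarrow> 'n tensor_field \<Rightarrow> 'n tensor_field" where
  "cov_deriv g T p is =
     (let j = last is; js = butlast is in
        partial j (\<lambda>q. T q js) p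
        - (\<Sum>s<length js. \<Sum>l\<in>UNIV. christoffel g p j (js ! s) l * T p (js[s := l])))"

fun nabla_R :: "'n::finite metric \<Rightarrow> nat \<Rightarrow> 'n tensor_field" where
  "nabla_R g 0 = (\<lambda>p is. curvature g p (is ! 0) (is ! 1) (is ! 2) (is ! 3))"
| "nabla_R g (Suc k) = cov_deriv g (nabla_R g k)"

definition tensor_eval :: "'n::finite tensor_field \<Rightarrow> real^'n \<Rightarrow> (real^'n) list \<Rightarrow> real" where
  "tensor_eval T p vs =
     (\<Sum>is | length is = length vs. T p is * (\<Prod>s<length vs. (vs ! s) $ (is ! s)))"

definition generalized_plane_wave :: "'n::{finite,linorder} metric \<Rightarrow> bool" where
  "generalized_plane_wave g \<longleftrightarrow>
     pseudo_riemannian g \<and>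
     (\<forall>p i j k. \<not> max i j < k \<longrightarrow> christoffel g p i j k = 0) \<and>
     (\<forall>p q i j k. (\<forall>l<k. p $ l = q $ l) \<longrightarrow> christoffel g p i j k = christoffel g q i j k)"

text \<open>The model of order \<open>k\<close> at \<open>P\<close> is the tangent space at \<open>P\<close> with the metric and
  \<open>R, \<nabla>R, \<dots>, \<nabla>\<^sup>kR\<close> at \<open>P\<close>.\<close>

definition model_isomorphism ::
    "nat \<Rightarrow> 'n::finite metric \<Rightarrow> real^'n \<Rightarrow> 'n metric \<Rightarrow> real^'n \<Rightarrow> (real^'n \<Rightarrow> real^'n) \<Rightarrow> bool" where
  "model_isomorphism k g\<^sub>1 P g\<^sub>2 Q \<Psi> \<longleftrightarrow>
     linear \<Psi> \<and> bij \<Psi> \<and>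
     (\<forall>v w. metric_form g\<^sub>2 Q (\<Psi> v) (\<Psi> w) = metric_form g\<^sub>1 P v w) \<and>
     (\<forall>i\<le>k. \<forall>vs. length vs = 4 + i \<longrightarrow>
        tensor_eval (nabla_R g\<^sub>2 i) Q (map \<Psi> vs) = tensor_eval (nabla_R g\<^sub>1 i) P vs)"

definition models_isomorphic ::
    "nat \<Rightarrow> 'n::finite metric \<Rightarrow> real^'n \<Rightarrow> 'n metric \<Rightarrow> real^'n \<Rightarrow> bool" where
  "models_isomorphic k g\<^sub>1 P g\<^sub>2 Q \<longleftrightarrow> (\<exists>\<Psi>. model_isomorphism k g\<^sub>1 P g\<^sub>2 Q \<Psi>)"

definition curvature_homogeneous :: "nat \<Rightarrow> 'n::finite metric \<Rightarrow> bool" where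
  "curvature_homogeneous k g \<longleftrightarrow> (\<forall>P Q. models_isomorphic k g P g Q)"

text \<open>On the open set \<open>U\<close> the Frechet derivative of the smooth map \<open>\<phi>\<close> is its differential,
  so the last condition says \<open>\<phi>\<^sup>* g\<^sub>2 = g\<^sub>1\<close>.\<close>

definition isometry_between ::
    "'n::finite metric \<Rightarrow> (real^'n) set \<Rightarrow> 'n metric \<Rightarrow> (real^'n) set \<Rightarrow> (real^'n \<Rightarrow> real^'n) \<Rightarrow> bool"
    where
  "isometry_between g\<^sub>1 U g\<^sub>2 V \<phi> \<longleftrightarrow>
     open U \<and> open V \<and> bij_betw \<phi> U V \<and>
     smooth_map_on U \<phi> \<and> smooth_map_on V (inv_into U \<phi>) \<and>
     (\<forall>p\<in>U. \<forall>v w. metric_form g\<^sub>2 (\<phi> p) (frechet_derivative \<phi> (at p) v) (frechet_derivative \<phi> (at p) w)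
                 = metric_form g\<^sub>1 p v w)"

text \<open>\<open>curvature_product g ks p is\<close> is the component at \<open>is\<close> of
  \<open>\<nabla>\<^bsup>k1\<^esup>R \<otimes> \<dots> \<otimes> \<nabla>\<^bsup>kr\<^esup>R\<close> for \<open>ks = [k1,\<dots>,kr]\<close>.\<close>

fun curvature_product :: "'n::finite metric \<Rightarrow> nat list \<Rightarrow> 'n tensor_field" where
  "curvature_product g [] p is = 1"
| "curvature_product g (k # ks) p is =
     nabla_R g k p (take (4 + k) is) * curvature_product g ks p (drop (4 + k) is)"

definition index_count :: "nat list \<Rightarrow> nat" where
  "index_count ks = (\<Sum>k\<leftarrow>ks. 4 + k)"

text \<open>A way to contract \<open>N\<close> index slots in pairs, as a fixed-point free involution.\<close>

definition pairing :: "nat \<Rightarrow> (nat \<Rightarrow> nat) \<Rightarrow> bool" where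
  "pairing N \<sigma> \<longleftrightarrow> (\<forall>s<N. \<sigma> s < N \<and> \<sigma> s \<noteq> s \<and> \<sigma> (\<sigma> s) = s)"

text \<open>All indices of \<open>\<nabla>\<^sup>kR\<close> are lowered, so a full contraction uses only the inverse metric;
  each pair \<open>{s, \<sigma> s}\<close> contributes one factor.\<close>

definition full_contraction ::
    "nat list \<Rightarrow> (nat \<Rightarrow> nat) \<Rightarrow> 'n::finite metric \<Rightarrow> real^'n \<Rightarrow> real" where
  "full_contraction ks \<sigma> g p =
     (\<Sum>is | length is = index_count ks.
        (\<Prod>s | s < index_count ks \<and> s < \<sigma> s. matrix_inv (g p) $ (is ! s) $ (is ! \<sigma> s)) *
        curvature_product g ks p is)"

text \<open>The empty product of curvature components is admitted, so constants count as Weyl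
  invariants.\<close>

inductive weyl_invariant :: "('n::finite metric \<Rightarrow> real^'n \<Rightarrow> real) \<Rightarrow> bool" where
  contraction: "pairing (index_count ks) \<sigma> \<Longrightarrow> weyl_invariant (full_contraction ks \<sigma>)"
| add: "weyl_invariant W \<Longrightarrow> weyl_invariant W' \<Longrightarrow> weyl_invariant (\<lambda>g p. W g p + W' g p)"
| scale: "weyl_invariant W \<Longrightarrow> weyl_invariant (\<lambda>g p. c * W g p)"

text \<open>Indices of the coordinates \<open>(x, y, z\<^sub>1, z\<^sub>2, y-tilde, x-tilde)\<close> on \<open>\<real>\<^sup>6\<close>, ordered as listed.\<close>

datatype coord = Cx | Cy | Cz1 | Cz2 | Cyt | Cxt

instance coord :: finite
proof
  have "(UNIV :: coord set) = {Cx, Cy, Cz1, Cz2, Cyt, Cxt}"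
    using coord.exhaust by auto
  then show "finite (UNIV :: coord set)"
    by (metis finite.emptyI finite.insertI)
qed

primrec coord_pos :: "coord \<Rightarrow> nat" where
  "coord_pos Cx = 1"
| "coord_pos Cy = 2"
| "coord_pos Cz1 = 3"
| "coord_pos Cz2 = 4"
| "coord_pos Cyt = 5"
| "coord_pos Cxt = 6"

lemma coord_pos_inject: "coord_pos i = coord_pos j \<longleftrightarrow> i = j"
  by (cases i; cases j) simp_all

instantiation coord :: linorder
begin

definition less_eq_coord :: "coord \<Rightarrow> coord \<Rightarrow> bool" where
  "i \<le> j \<longleftrightarrow> coord_pos i \<le> coord_pos j"

definition less_coord :: "coord \<Rightarrow> coord \<Rightarrow> bool" where
  "i < j \<longleftrightarrow> coord_pos i < coord_pos j"

instance
  by standard (auto simp: less_eq_coord_def less_coord_def coord_pos_inject)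

end

definition g6 :: "(real \<Rightarrow> real) \<Rightarrow> coord metric" where
  "g6 f p = (\<chi> i j.
     if (i, j) \<in> {(Cx, Cxt), (Cxt, Cx), (Cy, Cyt), (Cyt, Cy), (Cz1, Cz1), (Cz2, Cz2)} then 1
     else if (i, j) = (Cx, Cx) then - 2 * (p $ Cy * p $ Cz1 + f (p $ Cy) * p $ Cz2)
     else 0)"

definition alpha6 :: "(real \<Rightarrow> real) \<Rightarrow> real^coord \<Rightarrow> real" where
  "alpha6 f P = \<bar>deriv f (P $ Cy)\<bar> / sqrt (1 + (deriv f (P $ Cy))\<^sup>2)"

definition admissible :: "(real \<Rightarrow> real) \<Rightarrow> bool" where
  "admissible f \<longleftrightarrow> smooth_real f \<and> (\<forall>y. deriv (deriv f) y > 0)"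

end

theory Submission
  imports Defs
begin

text \<open>
  Put \<open>F = y z\<^sub>1 + f(y) z\<^sub>2\<close> (\<open>potential\<close>). The metric is the flat one, with \<open>x\<close> paired to \<open>x-tilde\<close> and
  \<open>y\<close> to \<open>y-tilde\<close>, plus \<open>- 2 F dx\<^sup>2\<close>. Since \<open>F\<close> depends on \<open>y, z\<^sub>1, z\<^sub>2\<close> only and \<open>dx\<close> is null, all
  quadratic terms in the curvature cancel: \<open>R\<close> is the product \<open>wedge_dx\<close> of \<open>dx\<^sup>2\<close> with the Hessian
  \<open>h = f'' z\<^sub>2 dy\<^sup>2 + 2 dy (dz\<^sub>1 + f' dz\<^sub>2)\<close>, and \<open>\<nabla>R\<close> is the same product with the third derivative
  \<open>f''' z\<^sub>2 dy\<^sup>3 + 3 f'' dy\<^sup>2 dz\<^sub>2\<close>.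

  Homogeneity of order zero: rotate the plane of \<open>z\<^sub>1, z\<^sub>2\<close> so that \<open>dz\<^sub>1 + f' dz\<^sub>2\<close> becomes a multiple of
  one coordinate covector, rescale \<open>dy\<close>, and absorb the \<open>dy\<^sup>2\<close> term by a null rotation. In the resulting
  coframe (\<open>normal_coframe\<close>) both the metric and \<open>h\<close> have constant coefficients, independent of \<open>f\<close> and
  of the point.

  The invariant: a covector \<open>R(u,v,w,\<cdot>)\<close> is a combination of \<open>dx\<close>, \<open>dy\<close> and \<open>dz\<^sub>1 + f' dz\<^sub>2\<close>, while
  \<open>\<nabla>R(u,v,w,\<cdot>;m)\<close> is a combination of \<open>dx\<close>, \<open>dy\<close> and \<open>dz\<^sub>2\<close>. The span of \<open>dx, dy\<close> is null and orthogonal to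
  all of these, so whenever both covectors have nonzero length, the cosine of the angle between them is
  \<open>\<plusminus> f' / sqrt (1 + f'\<^sup>2)\<close>. This is \<open>alpha6\<close> up to sign (\<open>angle_between_R_and_nabla_R\<close>), and \<open>f'' > 0\<close>
  provides covectors of both kinds that have nonzero length. As \<open>f'\<close> is strictly increasing, \<open>alpha6\<close> is not constant, which rules out
  homogeneity of order one.

  Isometries: the differential of an isometry is an isomorphism of the models of every order. This is the
  naturality of the Levi-Civita connection; it is proved for metrics in general, by differentiating the
  transformation law of the Christoffel symbols (\<open>isometry_imp_models_isomorphic\<close>).

  Weyl invariants: give the coordinate \<open>x\<close> weight 1, \<open>x-tilde\<close> weight -1, and the others weight 0. A
  component of \<open>\<nabla>\<^sup>kR\<close> can be nonzero only if its indices have total weight at least 2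
  (\<open>weight_nabla_R\<close>), whereas a component of the inverse metric can be nonzero only if its two indices have
  total weight at most 0. Hence every full contraction involving curvature vanishes, and Weyl invariants are
  constant on the family.
\<close>

section \<open>Directional derivatives and symmetry of second derivatives\<close>

text \<open>Built from partial derivatives, the form in which smoothness is given; where \<open>F\<close> is differentiable,
  \<open>dir_deriv F p\<close> is its Frechet derivative, which also makes sense of second and third derivatives as
  iterated directional derivatives with constant directions.\<close>

definition dir_deriv :: "(real^'n::finite \<Rightarrow> real) \<Rightarrow> real^'n \<Rightarrow> real^'n \<Rightarrow> real" where
  "dir_deriv F p u = (\<Sum>i\<in>UNIV. u $ i * partial i F p)"

lemma has_derivative_along_line:
  fixes F :: "'a::real_normed_vector \<Rightarrow> 'b::real_normed_vector"
  assumes "(F has_derivative F') (at (p + t *\<^sub>R u))"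
  shows "((\<lambda>t. F (p + t *\<^sub>R u)) has_vector_derivative F' u) (at t)"
proof -
  have "((\<lambda>t. F (p + t *\<^sub>R u)) has_derivative (\<lambda>s. F' (s *\<^sub>R u))) (at t)"
    by (rule has_derivative_compose[where g = F and f = "\<lambda>t. p + t *\<^sub>R u"])
       (auto intro!: derivative_eq_intros assms)
  then show ?thesis
    using has_derivative_linear[OF assms]
    by (simp add: has_vector_derivative_def linear_cmul)
qed

lemma partial_eq_derivative:
  assumes "(F has_derivative F') (at p)"
  shows "partial i F p = F' (axis i 1)"
proof -
  have "((\<lambda>t. F (p + t *\<^sub>R axis i 1)) has_vector_derivative F' (axis i 1)) (at 0)"
    using has_derivative_along_line[of F F' p 0 "axis i 1"] assms by simp
  then show ?thesis
    unfolding partial_def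
    by (intro DERIV_imp_deriv) (simp add: has_real_derivative_iff_has_vector_derivative)
qed

lemma vec_eq_sum_axis: "(v::real^'n) = (\<Sum>i\<in>UNIV. v $ i *\<^sub>R axis i 1)"
  by (simp add: vec_eq_iff axis_def if_distrib cong: if_cong)

lemma dir_deriv_eq_derivative:
  assumes "(F has_derivative F') (at p)"
  shows "dir_deriv F p = F'"
proof
  fix u
  have lin: "linear F'" using assms by (rule has_derivative_linear)
  have "F' u = F' (\<Sum>i\<in>UNIV. u $ i *\<^sub>R axis i 1)"
    using vec_eq_sum_axis[of u] by simp
  also have "\<dots> = (\<Sum>i\<in>UNIV. u $ i * F' (axis i 1))"
    by (simp add: linear_sum[OF lin] linear_cmul[OF lin])
  finally show "dir_deriv F p u = F' u"
    by (simp add: dir_deriv_def partial_eq_derivative[OF assms])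
qed

lemma has_derivative_dir_deriv:
  assumes "F differentiable at p"
  shows "(F has_derivative dir_deriv F p) (at p)"
  using assms dir_deriv_eq_derivative unfolding differentiable_def by metis

text \<open>The mean value theorem in the direction \<open>a\<close> turns the second difference into \<open>h\<close> times a first
  difference of \<open>q \<mapsto> F' q a\<close>, and differentiability of that function at the single point \<open>p\<close>
  evaluates it up to \<open>o(h)\<close>.\<close>

lemma second_difference_tendsto:
  fixes F :: "'a::real_normed_vector \<Rightarrow> real"
  assumes r: "r > 0" and F: "\<And>q. q \<in> ball p r \<Longrightarrow> (F has_derivative F' q) (at q)"
    and G: "((\<lambda>q. F' q a) has_derivative L) (at p)"
  shows "((\<lambda>h. (F (p + h *\<^sub>R a + h *\<^sub>R b) - F (p + h *\<^sub>R a) - F (p + h *\<^sub>R b) + F p) / h\<^sup>2)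
           \<longlongrightarrow> L b) (at_right 0)"
proof (rule tendstoI)
  fix \<epsilon> :: real assume \<epsilon>: "\<epsilon> > 0"
  \<comment> \<open>\<open>2 * norm a + norm b\<close> bounds the two remainders, taken at \<open>\<xi> a + h b\<close> and \<open>\<xi> a\<close>; adding 1 makes it positive.\<close>
  define K where "K = 2 * norm a + norm b + 1"
  have K: "K > 0" unfolding K_def by (smt (verit) norm_ge_zero)
  have lin: "linear L" using G by (rule has_derivative_linear)
  obtain d where d: "d > 0" and
    dL: "\<And>q. norm (q - p) < d \<Longrightarrow> \<bar>F' q a - F' p a - L (q - p)\<bar> \<le> \<epsilon> / (2 * K) * norm (q - p)"
    using G[unfolded has_derivative_at_alt] \<epsilon> K
    by (metis divide_pos_pos mult_pos_pos real_norm_def zero_less_numeral)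
  define \<delta> where "\<delta> = min d r / K"
  have "dist ((F (p + h *\<^sub>R a + h *\<^sub>R b) - F (p + h *\<^sub>R a) - F (p + h *\<^sub>R b) + F p) / h\<^sup>2) (L b) < \<epsilon>"
    if h: "0 < h" "h < \<delta>" for h
  proof -
    have hK: "h * K < min d r" using h K by (simp add: \<delta>_def pos_less_divide_eq)
    have small: "norm (\<xi> *\<^sub>R a + s *\<^sub>R b) \<le> h * (norm a + norm b)" "norm (\<xi> *\<^sub>R a + s *\<^sub>R b) < min d r"
      if "0 \<le> \<xi>" "\<xi> \<le> h" "0 \<le> s" "s \<le> h" for \<xi> s
    proof -
      have "norm (\<xi> *\<^sub>R a + s *\<^sub>R b) \<le> \<xi> * norm a + s * norm b"
        using that norm_triangle_ineq[of "\<xi> *\<^sub>R a" "s *\<^sub>R b"] by simp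
      also have "\<dots> \<le> h * norm a + h * norm b"
        using that by (intro add_mono mult_right_mono) auto
      finally show *: "norm (\<xi> *\<^sub>R a + s *\<^sub>R b) \<le> h * (norm a + norm b)"
        by (simp add: algebra_simps)
      have "h * (norm a + norm b) \<le> h * K"
        using h(1) norm_ge_zero[of a] unfolding K_def by (intro mult_left_mono) linarith+
      then show "norm (\<xi> *\<^sub>R a + s *\<^sub>R b) < min d r" using * hK by linarith
    qed
    define \<phi> where "\<phi> t = F ((p + h *\<^sub>R b) + t *\<^sub>R a) - F (p + t *\<^sub>R a)" for t
    have D: "DERIV \<phi> t :> F' (p + h *\<^sub>R b + t *\<^sub>R a) a - F' (p + t *\<^sub>R a) a"
      if t: "0 \<le> t" "t \<le> h" for t
    proof -
      have "dist p (p + h *\<^sub>R b + t *\<^sub>R a) < r" "dist p (p + t *\<^sub>R a) < r"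
        using small(2)[of t h] small(2)[of t 0] t h by (simp_all add: dist_norm norm_minus_commute algebra_simps)
      then show ?thesis
        unfolding \<phi>_def has_real_derivative_iff_has_vector_derivative
        by (intro has_vector_derivative_diff has_derivative_along_line F) auto
    qed
    obtain \<xi> where \<xi>: "0 < \<xi>" "\<xi> < h" and
      eq: "\<phi> h - \<phi> 0 = (h - 0) * (F' (p + h *\<^sub>R b + \<xi> *\<^sub>R a) a - F' (p + \<xi> *\<^sub>R a) a)"
      using MVT2[OF h(1) D] by blast
    have n1: "norm (h *\<^sub>R b + \<xi> *\<^sub>R a) \<le> h * (norm a + norm b)" "norm (h *\<^sub>R b + \<xi> *\<^sub>R a) < d"
      using small[of \<xi> h] \<xi> h by (auto simp: add.commute)
    have n2: "norm (\<xi> *\<^sub>R a) \<le> h * norm a" "norm (\<xi> *\<^sub>R a) < d"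
      using small(2)[of \<xi> 0] \<xi> h by (auto intro: mult_right_mono)
    have e1: "\<bar>F' (p + h *\<^sub>R b + \<xi> *\<^sub>R a) a - F' p a - L (h *\<^sub>R b + \<xi> *\<^sub>R a)\<bar>
                \<le> \<epsilon> / (2 * K) * (h * (norm a + norm b))"
      using dL[of "p + h *\<^sub>R b + \<xi> *\<^sub>R a"] n1 \<epsilon> K
      by (smt (verit) add_diff_cancel_left' add.assoc divide_nonneg_pos mult_left_mono zero_less_mult_iff)
    have e2: "\<bar>F' (p + \<xi> *\<^sub>R a) a - F' p a - L (\<xi> *\<^sub>R a)\<bar> \<le> \<epsilon> / (2 * K) * (h * norm a)"
      using dL[of "p + \<xi> *\<^sub>R a"] n2 \<epsilon> K
      by (smt (verit) add_diff_cancel_left' divide_nonneg_pos mult_left_mono zero_less_mult_iff)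
    have Lb: "L (h *\<^sub>R b + \<xi> *\<^sub>R a) - L (\<xi> *\<^sub>R a) = h * L b"
      by (simp add: linear_add[OF lin] linear_cmul[OF lin])
    have "\<bar>(F' (p + h *\<^sub>R b + \<xi> *\<^sub>R a) a - F' (p + \<xi> *\<^sub>R a) a) - h * L b\<bar>
            \<le> \<epsilon> / (2 * K) * (h * (norm a + norm b)) + \<epsilon> / (2 * K) * (h * norm a)"
      using e1 e2 Lb by linarith
    also have "\<dots> = \<epsilon> / (2 * K) * (h * (2 * norm a + norm b))"
      by (simp add: algebra_simps)
    also have "\<dots> \<le> \<epsilon> / (2 * K) * (h * K)"
      using \<epsilon> K h by (intro mult_left_mono) (auto simp: K_def)
    also have "\<dots> = h * (\<epsilon> / 2)" using K by simp
    finally have bd: "\<bar>(F' (p + h *\<^sub>R b + \<xi> *\<^sub>R a) a - F' (p + \<xi> *\<^sub>R a) a) - h * L b\<bar> \<le> h * (\<epsilon> / 2)" .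
    have "F (p + h *\<^sub>R a + h *\<^sub>R b) - F (p + h *\<^sub>R a) - F (p + h *\<^sub>R b) + F p = \<phi> h - \<phi> 0"
      by (simp add: \<phi>_def algebra_simps)
    then have "(F (p + h *\<^sub>R a + h *\<^sub>R b) - F (p + h *\<^sub>R a) - F (p + h *\<^sub>R b) + F p) / h\<^sup>2 - L b
       = ((F' (p + h *\<^sub>R b + \<xi> *\<^sub>R a) a - F' (p + \<xi> *\<^sub>R a) a) - h * L b) / h"
      using h eq by (simp add: diff_divide_distrib power2_eq_square)
    then have "\<bar>(F (p + h *\<^sub>R a + h *\<^sub>R b) - F (p + h *\<^sub>R a) - F (p + h *\<^sub>R b) + F p) / h\<^sup>2 - L b\<bar> \<le> \<epsilon> / 2"
      using bd h by (simp add: pos_divide_le_eq mult.commute)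
    then show ?thesis using \<epsilon> by (simp add: dist_real_def)
  qed
  moreover have "\<delta> > 0" using d r K by (simp add: \<delta>_def)
  ultimately show "\<forall>\<^sub>F h in at_right 0.
     dist ((F (p + h *\<^sub>R a + h *\<^sub>R b) - F (p + h *\<^sub>R a) - F (p + h *\<^sub>R b) + F p) / h\<^sup>2) (L b) < \<epsilon>"
    unfolding eventually_at_right_field by blast
qed

text \<open>The second difference does not change when the two directions are exchanged, so its limit can be
  computed with either of them taken first.\<close>

lemma second_derivative_symmetric:
  fixes F :: "'a::real_normed_vector \<Rightarrow> real"
  assumes U: "open U" "p \<in> U" and F: "\<And>q. q \<in> U \<Longrightarrow> (F has_derivative F' q) (at q)"
    and a: "((\<lambda>q. F' q a) has_derivative La) (at p)"
    and b: "((\<lambda>q. F' q b) has_derivative Lb) (at p)"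
  shows "La b = Lb a"
proof -
  obtain r where r: "r > 0" "ball p r \<subseteq> U" using U by (meson openE)
  have F': "(F has_derivative F' q) (at q)" if "q \<in> ball p r" for q
    using that r F by blast
  have "(\<lambda>h. (F (p + h *\<^sub>R a + h *\<^sub>R b) - F (p + h *\<^sub>R a) - F (p + h *\<^sub>R b) + F p) / h\<^sup>2)
      = (\<lambda>h. (F (p + h *\<^sub>R b + h *\<^sub>R a) - F (p + h *\<^sub>R b) - F (p + h *\<^sub>R a) + F p) / h\<^sup>2)"
    by (simp add: algebra_simps)
  with second_difference_tendsto[OF r(1) F' a, of b]
       second_difference_tendsto[OF r(1) F' b, of a]
  show ?thesis
    by (metis (no_types, lifting) tendsto_unique trivial_limit_at_right_real)
qed

lemma dir_deriv_axis [simp]: "dir_deriv F p (axis i 1) = partial i F p"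
  by (simp add: dir_deriv_def axis_def if_distrib[of "\<lambda>x. x * _"] cong: if_cong)

lemma dir_deriv_add: "dir_deriv F p (u + v) = dir_deriv F p u + dir_deriv F p v"
  by (simp add: dir_deriv_def algebra_simps sum.distrib)

lemma dir_deriv_scale: "dir_deriv F p (c *\<^sub>R u) = c * dir_deriv F p u"
  by (simp add: dir_deriv_def algebra_simps sum_distrib_left)

lemma has_derivative_vec_nth_iff:
  fixes f :: "'a::euclidean_space \<Rightarrow> real^'n"
  shows "(f has_derivative f') (at p) \<longleftrightarrow> (\<forall>i. ((\<lambda>q. f q $ i) has_derivative (\<lambda>u. f' u $ i)) (at p))"
  unfolding has_derivative_componentwise_within[of f]
  by (auto simp: Basis_vec_def inner_axis)

lemma smooth_on_differentiable: "smooth_on U F \<Longrightarrow> p \<in> U \<Longrightarrow> F differentiable at p"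
  unfolding smooth_on_def by (metis foldr.simps(1) id_apply)

lemma smooth_on_partial: "smooth_on U F \<Longrightarrow> smooth_on U (partial i F)"
  unfolding smooth_on_def
proof (intro allI ballI)
  fix "is" p assume "\<forall>is. \<forall>p\<in>U. foldr partial is F differentiable at p" "p \<in> U"
  then have "foldr partial (is @ [i]) F differentiable at p" by blast
  then show "foldr partial is (partial i F) differentiable at p" by simp
qed

lemma dir_deriv_has_derivative:
  assumes "smooth_on U F" "p \<in> U"
  shows "((\<lambda>q. dir_deriv F q v) has_derivative (\<lambda>u. \<Sum>i\<in>UNIV. v $ i * dir_deriv (partial i F) p u)) (at p)"
  unfolding dir_deriv_def[of F]
  by (intro has_derivative_sum has_derivative_mult_right has_derivative_dir_deriv
        smooth_on_differentiable[OF smooth_on_partial[OF assms(1)] assms(2)])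

lemma dir_deriv_dir_deriv:
  assumes "smooth_on U F" "p \<in> U"
  shows "dir_deriv (\<lambda>q. dir_deriv F q v) p u = (\<Sum>i\<in>UNIV. v $ i * dir_deriv (partial i F) p u)"
  using dir_deriv_eq_derivative[OF dir_deriv_has_derivative[OF assms]] by metis

lemma dir_deriv_differentiable:
  assumes "smooth_on U F" "p \<in> U"
  shows "(\<lambda>q. dir_deriv F q v) differentiable at p"
  using dir_deriv_has_derivative[OF assms] by (rule differentiableI)

lemma dir_deriv2_differentiable:
  assumes "smooth_on U F" "open U" "p \<in> U"
  shows "(\<lambda>q. dir_deriv (\<lambda>r. dir_deriv F r v) q u) differentiable at p"
proof -
  have "((\<lambda>q. \<Sum>i\<in>UNIV. v $ i * dir_deriv (partial i F) q u) has_derivative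
      (\<lambda>w. \<Sum>i\<in>UNIV. v $ i * dir_deriv (\<lambda>q. dir_deriv (partial i F) q u) p w)) (at p)" (is "(_ has_derivative ?D) _")
    by (intro has_derivative_sum has_derivative_mult_right has_derivative_dir_deriv
          dir_deriv_differentiable[OF smooth_on_partial[OF assms(1)] assms(3)])
  then have "((\<lambda>q. dir_deriv (\<lambda>r. dir_deriv F r v) q u) has_derivative ?D) (at p)"
    by (rule has_derivative_transform_within_open[OF _ assms(2,3)])
       (simp add: dir_deriv_dir_deriv[OF assms(1)])
  then show ?thesis by (rule differentiableI)
qed

lemma dir_deriv_commute:
  assumes "open U" "p \<in> U" and F: "\<And>q. q \<in> U \<Longrightarrow> F differentiable at q"
    and "(\<lambda>q. dir_deriv F q u) differentiable at p" "(\<lambda>q. dir_deriv F q v) differentiable at p"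
  shows "dir_deriv (\<lambda>q. dir_deriv F q u) p v = dir_deriv (\<lambda>q. dir_deriv F q v) p u"
  using second_derivative_symmetric[of U p F "dir_deriv F"] assms has_derivative_dir_deriv by metis

section \<open>Sums over index lists\<close>

lemma sum_index_lists_snoc:
  "(\<Sum>is | length is = Suc n. F is) = (\<Sum>js | length js = n. \<Sum>j\<in>(UNIV::'n::finite set). F (js @ [j]))"
proof -
  have "(\<Sum>js | length js = n. \<Sum>j\<in>(UNIV::'n::finite set). F (js @ [j]))
      = (\<Sum>(js, j)\<in>{js. length js = n} \<times> UNIV. F (js @ [j]))"
    by (rule sum.cartesian_product)
  also have "\<dots> = (\<Sum>is | length is = Suc n. F is)"
    by (rule sum.reindex_bij_witness[of _ "\<lambda>is. (butlast is, last is)" "\<lambda>(js, j). js @ [j]"])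
       (auto, metis append_butlast_last_id list.size(3) nat.distinct(1))
  finally show ?thesis ..
qed

lemma sum_index_lists_Cons:
  "(\<Sum>is | length is = Suc n. F is) = (\<Sum>j\<in>(UNIV::'n::finite set). \<Sum>js | length js = n. F (j # js))"
proof -
  have "(\<Sum>j\<in>(UNIV::'n::finite set). \<Sum>js | length js = n. F (j # js))
      = (\<Sum>(j, js)\<in>UNIV \<times> {js. length js = n}. F (j # js))"
    by (rule sum.cartesian_product)
  also have "\<dots> = (\<Sum>is | length is = Suc n. F is)"
    by (rule sum.reindex_bij_witness[of _ "\<lambda>is. (hd is, tl is)" "\<lambda>(j, js). j # js"])
       (auto simp: length_Suc_conv)
  finally show ?thesis ..
qed

text \<open>Exchanging the entry at position \<open>s\<close> with the extra index is an involution. In a covariant derivative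
  this moves the Christoffel symbol off the tensor index and onto the argument in that slot.\<close>

lemma sum_index_lists_exchange:
  fixes H :: "'n::finite list \<Rightarrow> 'n \<Rightarrow> real"
  assumes "s < n"
  shows "(\<Sum>js | length js = n. \<Sum>l\<in>UNIV. H (js[s := l]) (js ! s)) = (\<Sum>js | length js = n. \<Sum>l\<in>UNIV. H js l)"
  unfolding sum.cartesian_product
  by (rule sum.reindex_bij_witness[of _ "\<lambda>(js, l). (js[s := l], js ! s)" "\<lambda>(js, l). (js[s := l], js ! s)"])
     (use assms in auto)

section \<open>Multilinear evaluation\<close>

lemma prod_list_update:
  fixes vs :: "(real^'n) list"
  assumes "s < length vs"
  shows "(\<Prod>t<length vs. (vs[s := x] ! t) $ (js ! t)) = x $ (js ! s) * (\<Prod>t\<in>{..<length vs} - {s}. (vs ! t) $ (js ! t))"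
proof -
  have "(\<Prod>t<length vs. (vs[s := x] ! t) $ (js ! t))
      = (vs[s := x] ! s) $ (js ! s) * (\<Prod>t\<in>{..<length vs} - {s}. (vs[s := x] ! t) $ (js ! t))"
    by (rule prod.remove) (use assms in auto)
  also have "(\<Prod>t\<in>{..<length vs} - {s}. (vs[s := x] ! t) $ (js ! t)) = (\<Prod>t\<in>{..<length vs} - {s}. (vs ! t) $ (js ! t))"
    by (intro prod.cong) auto
  finally show ?thesis using assms by simp
qed

lemma tensor_eval_update:
  assumes "s < length vs"
  shows "tensor_eval T p (vs[s := x])
    = (\<Sum>js | length js = length vs. T p js * (x $ (js ! s) * (\<Prod>t\<in>{..<length vs} - {s}. (vs ! t) $ (js ! t))))"
  unfolding tensor_eval_def by (simp add: prod_list_update[OF assms])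

lemma tensor_eval_update_add:
  assumes "s < length vs"
  shows "tensor_eval T p (vs[s := x + y]) = tensor_eval T p (vs[s := x]) + tensor_eval T p (vs[s := y])"
  by (simp add: tensor_eval_update[OF assms] algebra_simps sum.distrib)

lemma tensor_eval_Nil: "tensor_eval T p [] = T p []"
  by (simp add: tensor_eval_def)

lemma tensor_eval_Cons:
  "tensor_eval T p (v # vs) = (\<Sum>i\<in>UNIV. v $ i * tensor_eval (\<lambda>q is. T q (i # is)) p vs)"
  unfolding tensor_eval_def
  by (simp add: sum_index_lists_Cons prod.lessThan_Suc_shift sum_distrib_left mult_ac del: prod.lessThan_Suc)

lemmas tensor_eval_Cons_Nil = tensor_eval_Cons tensor_eval_Nil

text \<open>The componentwise derivative in the direction \<open>u\<close>, which is a tensor only for a fixed choice of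
  coordinates.\<close>

abbreviation directional_tensor :: "'n::finite tensor_field \<Rightarrow> real^'n \<Rightarrow> 'n tensor_field" where
  "directional_tensor T u \<equiv> (\<lambda>p is. dir_deriv (\<lambda>q. T q is) p u)"

text \<open>\<open>\<nabla>\<^bsub>v\<^esub> w\<close> for vector fields \<open>v\<close>, \<open>w\<close> with constant components.\<close>

definition christoffel_form :: "'n::finite metric \<Rightarrow> real^'n \<Rightarrow> real^'n \<Rightarrow> real^'n \<Rightarrow> real^'n" where
  "christoffel_form g p v w = (\<chi> k. \<Sum>i\<in>UNIV. \<Sum>j\<in>UNIV. v $ i * (w $ j * christoffel g p i j k))"

text \<open>The Leibniz rule \<open>(\<nabla>\<^bsub>w\<^esub> T)(v\<^sub>1,\<dots>) = w(T(v\<^sub>1,\<dots>)) - \<Sum>\<^sub>s T(\<dots>, \<nabla>\<^bsub>w\<^esub> v\<^sub>s, \<dots>)\<close> for vector fields with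
  constant components. It replaces index manipulation by multilinearity in everything that follows.\<close>

lemma tensor_eval_cov_deriv:
  "tensor_eval (cov_deriv g T) p (vs @ [w])
    = tensor_eval (directional_tensor T w) p vs
      - (\<Sum>s<length vs. tensor_eval T p (vs[s := christoffel_form g p w (vs ! s)]))"
proof -
  let ?n = "length vs"
  let ?P = "\<lambda>js. \<Prod>t<?n. (vs ! t) $ (js ! t)"
  let ?Q = "\<lambda>s js. \<Prod>t\<in>{..<?n} - {s}. (vs ! t) $ (js ! t)"
  let ?C = "\<lambda>j s js l. christoffel g p j (js ! s) l * T p (js[s := l])"
  have snoc: "(\<Prod>s<Suc ?n. ((vs @ [w]) ! s) $ ((js @ [j]) ! s)) = ?P js * w $ j" if "length js = ?n" for js j
    using that by (simp add: nth_append)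
  have P: "?P js = (vs ! s) $ (js ! s) * ?Q s js" if "s < ?n" for s js
    by (rule prod.remove) (use that in auto)
  have slot: "(\<Sum>js | length js = ?n. \<Sum>j\<in>UNIV. (\<Sum>l\<in>UNIV. ?C j s js l) * (?P js * w $ j))
      = tensor_eval T p (vs[s := christoffel_form g p w (vs ! s)])" if s: "s < ?n" for s
  proof -
    \<comment> \<open>Summand after the exchange: \<open>js\<close> carries the index contracted with \<open>\<Gamma>\<close>, and \<open>m\<close> is the index of \<open>v\<^sub>s\<close>.\<close>
    define H where "H js m = (\<Sum>j\<in>UNIV. w $ j * ((vs ! s) $ m * christoffel g p j m (js ! s)) * (T p js * ?Q s js))"
      for js m
    have "(\<Sum>js | length js = ?n. \<Sum>j\<in>UNIV. (\<Sum>l\<in>UNIV. ?C j s js l) * (?P js * w $ j))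
        = (\<Sum>js | length js = ?n. \<Sum>l\<in>UNIV. H (js[s := l]) (js ! s))"
    proof (rule sum.cong[OF refl])
      fix js :: "'a list" assume "js \<in> {js. length js = ?n}"
      then have len: "length js = ?n" by simp
      have Q: "?Q s (js[s := l]) = ?Q s js" for l by (intro prod.cong) auto
      show "(\<Sum>j\<in>UNIV. (\<Sum>l\<in>UNIV. ?C j s js l) * (?P js * w $ j)) = (\<Sum>l\<in>UNIV. H (js[s := l]) (js ! s))"
        unfolding H_def Q P[OF s] sum_distrib_right
        by (subst sum.swap) (use s len in \<open>simp add: mult_ac\<close>)
    qed
    also have "\<dots> = (\<Sum>js | length js = ?n. \<Sum>l\<in>UNIV. H js l)"
      by (rule sum_index_lists_exchange[OF s])
    also have "\<dots> = tensor_eval T p (vs[s := christoffel_form g p w (vs ! s)])"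
      unfolding tensor_eval_update[OF s] H_def christoffel_form_def vec_lambda_beta
      by (intro sum.cong refl, subst sum.swap) (simp add: sum_distrib_left sum_distrib_right mult_ac)
    finally show ?thesis .
  qed
  have "tensor_eval (cov_deriv g T) p (vs @ [w])
      = (\<Sum>js | length js = ?n. \<Sum>j\<in>UNIV. cov_deriv g T p (js @ [j]) * (?P js * w $ j))"
    unfolding tensor_eval_def length_append_singleton sum_index_lists_snoc by (simp add: snoc del: prod.lessThan_Suc)
  also have "\<dots> = (\<Sum>js | length js = ?n. \<Sum>j\<in>UNIV. partial j (\<lambda>q. T q js) p * (?P js * w $ j))
      - (\<Sum>js | length js = ?n. \<Sum>j\<in>UNIV. (\<Sum>s<?n. \<Sum>l\<in>UNIV. ?C j s js l) * (?P js * w $ j))"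
    unfolding sum_subtractf[symmetric] by (simp add: cov_deriv_def left_diff_distrib)
  also have "(\<Sum>js | length js = ?n. \<Sum>j\<in>UNIV. partial j (\<lambda>q. T q js) p * (?P js * w $ j))
      = tensor_eval (directional_tensor T w) p vs"
    by (simp add: tensor_eval_def dir_deriv_def sum_distrib_left sum_distrib_right mult_ac)
  also have "(\<Sum>js | length js = ?n. \<Sum>j\<in>UNIV. (\<Sum>s<?n. \<Sum>l\<in>UNIV. ?C j s js l) * (?P js * w $ j))
      = (\<Sum>s<?n. \<Sum>js | length js = ?n. \<Sum>j\<in>UNIV. (\<Sum>l\<in>UNIV. ?C j s js l) * (?P js * w $ j))"
  proof -
    have "(\<Sum>js | length js = ?n. \<Sum>j\<in>UNIV. (\<Sum>s<?n. \<Sum>l\<in>UNIV. ?C j s js l) * (?P js * w $ j))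
        = (\<Sum>js | length js = ?n. \<Sum>s<?n. \<Sum>j\<in>UNIV. (\<Sum>l\<in>UNIV. ?C j s js l) * (?P js * w $ j))"
      unfolding sum_distrib_right[of _ "{..<?n}"] by (intro sum.cong refl sum.swap)
    then show ?thesis by (subst (asm) sum.swap[of _ "{..<?n}"])
  qed
  also have "\<dots> = (\<Sum>s<?n. tensor_eval T p (vs[s := christoffel_form g p w (vs ! s)]))"
    by (intro sum.cong refl slot) auto
  finally show ?thesis .
qed

text \<open>The product rule for a tensor field along \<open>\<phi>\<close>, evaluated at vector fields along \<open>\<phi>\<close>.\<close>

lemma has_derivative_tensor_eval:
  fixes \<phi> :: "real^'n::finite \<Rightarrow> real^'n" and V :: "(real^'n \<Rightarrow> real^'n) list"
  assumes T: "\<And>is. length is = length V \<Longrightarrow> (\<lambda>q. T q is) differentiable at (\<phi> p)"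
    and \<phi>: "(\<phi> has_derivative J) (at p)"
    and V: "\<And>s. s < length V \<Longrightarrow> (V ! s has_derivative DV s) (at p)"
  shows "((\<lambda>q. tensor_eval T (\<phi> q) (map (\<lambda>X. X q) V)) has_derivative
     (\<lambda>u. tensor_eval (directional_tensor T (J u)) (\<phi> p) (map (\<lambda>X. X p) V)
          + (\<Sum>s<length V. tensor_eval T (\<phi> p) ((map (\<lambda>X. X p) V)[s := DV s u])))) (at p)"
proof -
  let ?n = "length V"
  have Tc: "((\<lambda>q. T (\<phi> q) is) has_derivative (\<lambda>u. dir_deriv (\<lambda>q. T q is) (\<phi> p) (J u))) (at p)"
    if "length is = ?n" for "is"
    by (rule has_derivative_compose[OF \<phi> has_derivative_dir_deriv[OF T[OF that]]])
  have Pc: "((\<lambda>q. \<Prod>s<?n. (V ! s) q $ (is ! s)) has_derivative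
      (\<lambda>u. \<Sum>s<?n. DV s u $ (is ! s) * (\<Prod>t\<in>{..<?n} - {s}. (V ! t) p $ (is ! t)))) (at p)" for "is"
    by (rule has_derivative_prod) (use V in \<open>simp add: has_derivative_vec_nth_iff\<close>)
  have "((\<lambda>q. \<Sum>is | length is = ?n. T (\<phi> q) is * (\<Prod>s<?n. (V ! s) q $ (is ! s))) has_derivative
     (\<lambda>u. \<Sum>is | length is = ?n. T (\<phi> p) is * (\<Sum>s<?n. DV s u $ (is ! s) * (\<Prod>t\<in>{..<?n} - {s}. (V ! t) p $ (is ! t)))
        + dir_deriv (\<lambda>q. T q is) (\<phi> p) (J u) * (\<Prod>s<?n. (V ! s) p $ (is ! s)))) (at p)"
    by (intro has_derivative_sum has_derivative_mult Tc Pc) auto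
  moreover have "tensor_eval T (\<phi> p) ((map (\<lambda>X. X p) V)[s := x])
     = (\<Sum>is | length is = ?n. T (\<phi> p) is * (x $ (is ! s) * (\<Prod>t\<in>{..<?n} - {s}. (V ! t) p $ (is ! t))))"
     if "s < ?n" for s x
    using tensor_eval_update[of s "map (\<lambda>X. X p) V" T "\<phi> p" x] that by simp
  moreover have "(\<Sum>is | length is = ?n. T (\<phi> p) is * (\<Sum>s<?n. DV s u $ (is ! s) * (\<Prod>t\<in>{..<?n} - {s}. (V ! t) p $ (is ! t))))
     = (\<Sum>s<?n. \<Sum>is | length is = ?n. T (\<phi> p) is * (DV s u $ (is ! s) * (\<Prod>t\<in>{..<?n} - {s}. (V ! t) p $ (is ! t))))" for u
    unfolding sum_distrib_left by (rule sum.swap)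
  moreover have "tensor_eval S q (map (\<lambda>X. X r) V) = (\<Sum>is | length is = ?n. S q is * (\<Prod>s<?n. (V ! s) r $ (is ! s)))"
    for S :: "'n tensor_field" and q r
    by (simp add: tensor_eval_def)
  ultimately show ?thesis
    by (simp add: sum.distrib add.commute)
qed

lemma has_derivative_tensor_eval_const:
  assumes "\<And>is. length is = length vs \<Longrightarrow> (\<lambda>q. T q is) differentiable at p"
  shows "((\<lambda>q. tensor_eval T q vs) has_derivative (\<lambda>u. tensor_eval (directional_tensor T u) p vs)) (at p)"
proof -
  have "((\<lambda>q. tensor_eval T (id q) (map (\<lambda>X. X q) (map (\<lambda>v q. v) vs))) has_derivative
     (\<lambda>u. tensor_eval (directional_tensor T u) (id p) (map (\<lambda>X. X p) (map (\<lambda>v q. v) vs))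
        + (\<Sum>s<length (map (\<lambda>v (q::real^'a). v) vs).
            tensor_eval T (id p) ((map (\<lambda>X. X p) (map (\<lambda>v q. v) vs))[s := 0])))) (at p)"
    by (rule has_derivative_tensor_eval) (auto intro: assms simp: id_def)
  moreover have "tensor_eval T p (vs[s := 0]) = 0" if "s < length vs" for s
    using that by (simp add: tensor_eval_update)
  ultimately show ?thesis by (simp add: comp_def)
qed


section \<open>Differentials of a smooth map\<close>

definition differential :: "(real^'n::finite \<Rightarrow> real^'n) \<Rightarrow> real^'n \<Rightarrow> real^'n \<Rightarrow> real^'n" where
  "differential \<phi> p v = (\<chi> c. dir_deriv (\<lambda>q. \<phi> q $ c) p v)"

definition second_differential :: "(real^'n::finite \<Rightarrow> real^'n) \<Rightarrow> real^'n \<Rightarrow> real^'n \<Rightarrow> real^'n \<Rightarrow> real^'n" where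
  "second_differential \<phi> p u v = (\<chi> c. dir_deriv (\<lambda>q. dir_deriv (\<lambda>r. \<phi> r $ c) q v) p u)"

definition third_differential ::
    "(real^'n::finite \<Rightarrow> real^'n) \<Rightarrow> real^'n \<Rightarrow> real^'n \<Rightarrow> real^'n \<Rightarrow> real^'n \<Rightarrow> real^'n" where
  "third_differential \<phi> p u v w =
     (\<chi> c. dir_deriv (\<lambda>q. dir_deriv (\<lambda>r. dir_deriv (\<lambda>t. \<phi> t $ c) r w) q v) p u)"

lemma has_derivative_differential:
  assumes "smooth_map_on U \<phi>" "p \<in> U"
  shows "(\<phi> has_derivative differential \<phi> p) (at p)"
  using assms unfolding has_derivative_vec_nth_iff differential_def smooth_map_on_def
  by (auto intro!: has_derivative_dir_deriv intro: smooth_on_differentiable)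

lemma has_derivative_second_differential:
  assumes "smooth_map_on U \<phi>" "p \<in> U"
  shows "((\<lambda>q. differential \<phi> q v) has_derivative (\<lambda>u. second_differential \<phi> p u v)) (at p)"
  using assms unfolding has_derivative_vec_nth_iff differential_def second_differential_def smooth_map_on_def
  by (auto intro!: has_derivative_dir_deriv intro: dir_deriv_differentiable)

lemma has_derivative_third_differential:
  assumes "smooth_map_on U \<phi>" "open U" "p \<in> U"
  shows "((\<lambda>q. second_differential \<phi> q v w) has_derivative (\<lambda>u. third_differential \<phi> p u v w)) (at p)"
  using assms unfolding has_derivative_vec_nth_iff second_differential_def third_differential_def smooth_map_on_def
  by (auto intro!: has_derivative_dir_deriv intro: dir_deriv2_differentiable)

lemma second_differential_commute:
  assumes "smooth_map_on U \<phi>" "open U" "p \<in> U"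
  shows "second_differential \<phi> p u v = second_differential \<phi> p v u"
  unfolding second_differential_def vec_eq_iff vec_lambda_beta
proof
  fix c
  have s: "smooth_on U (\<lambda>q. \<phi> q $ c)" using assms(1) by (simp add: smooth_map_on_def)
  show "dir_deriv (\<lambda>q. dir_deriv (\<lambda>r. \<phi> r $ c) q v) p u = dir_deriv (\<lambda>q. dir_deriv (\<lambda>r. \<phi> r $ c) q u) p v"
    by (rule dir_deriv_commute[OF assms(2,3)])
       (use assms s in \<open>auto intro: smooth_on_differentiable dir_deriv_differentiable\<close>)
qed

lemma third_differential_commute:
  assumes "smooth_map_on U \<phi>" "open U" "p \<in> U"
  shows "third_differential \<phi> p u v w = third_differential \<phi> p v u w"
  unfolding third_differential_def vec_eq_iff vec_lambda_beta
proof
  fix c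
  have s: "smooth_on U (\<lambda>q. \<phi> q $ c)" using assms(1) by (simp add: smooth_map_on_def)
  show "dir_deriv (\<lambda>q. dir_deriv (\<lambda>r. dir_deriv (\<lambda>t. \<phi> t $ c) r w) q v) p u
      = dir_deriv (\<lambda>q. dir_deriv (\<lambda>r. dir_deriv (\<lambda>t. \<phi> t $ c) r w) q u) p v"
    by (rule dir_deriv_commute[OF assms(2,3)])
       (use assms s in \<open>auto intro: dir_deriv_differentiable dir_deriv2_differentiable\<close>)
qed

lemma differential_add: "differential \<phi> p (u + v) = differential \<phi> p u + differential \<phi> p v"
  by (simp add: differential_def vec_eq_iff dir_deriv_add)

lemma differential_diff: "differential \<phi> p (u - v) = differential \<phi> p u - differential \<phi> p v"
  using differential_add[of \<phi> p "u - v" v] by simp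

lemma linear_differential: "linear (differential \<phi> p)"
  by (rule linearI) (simp_all add: differential_def vec_eq_iff dir_deriv_add dir_deriv_scale)

text \<open>The differential applied to a vector field is differentiated by the product rule; writing it as a
  finite sum over components avoids derivatives of operator-valued maps.\<close>

lemma has_derivative_differential_apply:
  assumes "smooth_map_on U \<phi>" "p \<in> U" and X: "(X has_derivative DX) (at p)"
  shows "((\<lambda>q. differential \<phi> q (X q)) has_derivative
            (\<lambda>u. differential \<phi> p (DX u) + second_differential \<phi> p u (X p))) (at p)"
  unfolding has_derivative_vec_nth_iff
proof
  fix c
  have s: "smooth_on U (\<lambda>q. \<phi> q $ c)" using assms(1) by (simp add: smooth_map_on_def)
  have "((\<lambda>q. X q $ i) has_derivative (\<lambda>u. DX u $ i)) (at p)" for i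
    using X by (simp add: has_derivative_vec_nth_iff)
  then have "((\<lambda>q. \<Sum>i\<in>UNIV. X q $ i * partial i (\<lambda>q. \<phi> q $ c) q) has_derivative
      (\<lambda>u. \<Sum>i\<in>UNIV. X p $ i * dir_deriv (partial i (\<lambda>q. \<phi> q $ c)) p u + DX u $ i * partial i (\<lambda>q. \<phi> q $ c) p)) (at p)"
    by (intro has_derivative_sum has_derivative_mult has_derivative_dir_deriv
          smooth_on_differentiable[OF smooth_on_partial[OF s] assms(2)]) auto
  then show "((\<lambda>q. differential \<phi> q (X q) $ c) has_derivative
      (\<lambda>u. (differential \<phi> p (DX u) + second_differential \<phi> p u (X p)) $ c)) (at p)"
    unfolding vector_add_component differential_def second_differential_def vec_lambda_beta
      dir_deriv_dir_deriv[OF s assms(2)]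
    unfolding dir_deriv_def[of "\<lambda>q. \<phi> q $ c"] by (simp add: sum.distrib add.commute)
qed

lemma tensor_eval_pair:
  "tensor_eval T p [v, w] = (\<Sum>i\<in>UNIV. \<Sum>j\<in>UNIV. v $ i * (w $ j * T p [i, j]))"
  by (simp add: tensor_eval_Cons_Nil sum_distrib_left)

lemma has_derivative_tensor_eval_pair:
  fixes \<phi> :: "real^'n::finite \<Rightarrow> real^'n"
  assumes T: "\<And>is. (\<lambda>q. T q is) differentiable at (\<phi> p)"
    and \<phi>: "(\<phi> has_derivative J) (at p)"
    and X: "(X has_derivative DX) (at p)" and Y: "(Y has_derivative DY) (at p)"
  shows "((\<lambda>q. tensor_eval T (\<phi> q) [X q, Y q]) has_derivative
     (\<lambda>u. tensor_eval (directional_tensor T (J u)) (\<phi> p) [X p, Y p]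
          + (tensor_eval T (\<phi> p) [DX u, Y p] + tensor_eval T (\<phi> p) [X p, DY u]))) (at p)"
proof -
  have "([X, Y] ! s has_derivative [DX, DY] ! s) (at p)" if "s < length [X, Y]" for s
    using that X Y by (auto simp: less_Suc_eq)
  from has_derivative_tensor_eval[OF T \<phi> this] show ?thesis
    by simp
qed

section \<open>Connection and curvature as multilinear maps\<close>

text \<open>The metric and, for each upper index, the Christoffel symbols are treated as tensor fields of rank two,
  so that the product rule \<open>has_derivative_tensor_eval_pair\<close> serves for both.\<close>

definition metric_field :: "'n::finite metric \<Rightarrow> 'n tensor_field" where
  "metric_field g p is = g p $ (is ! 0) $ (is ! 1)"

lemma metric_form_eq: "metric_form g p v w = tensor_eval (metric_field g) p [v, w]"
  by (simp add: metric_form_def tensor_eval_pair metric_field_def inner_vec_def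
      matrix_vector_mult_def sum_distrib_left mult_ac)

definition christoffel_field :: "'n::finite metric \<Rightarrow> 'n \<Rightarrow> 'n tensor_field" where
  "christoffel_field g k p is = christoffel g p (is ! 0) (is ! 1) k"

lemma christoffel_form_eq: "christoffel_form g p v w $ k = tensor_eval (christoffel_field g k) p [v, w]"
  by (simp add: christoffel_form_def tensor_eval_pair christoffel_field_def)

lemma christoffel_form_add_right: "christoffel_form g p w (u + v) = christoffel_form g p w u + christoffel_form g p w v"
  by (simp add: christoffel_form_def vec_eq_iff algebra_simps sum.distrib)

definition christoffel_deriv :: "'n::finite metric \<Rightarrow> real^'n \<Rightarrow> real^'n \<Rightarrow> real^'n \<Rightarrow> real^'n \<Rightarrow> real^'n" where
  "christoffel_deriv g p u v w = (\<chi> k. tensor_eval (directional_tensor (christoffel_field g k) u) p [v, w])"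

text \<open>\<open>R(a,b)c = \<nabla>\<^sub>a \<nabla>\<^sub>b c - \<nabla>\<^sub>b \<nabla>\<^sub>a c\<close> for fields with constant components, whose brackets vanish. The
  grouping exhibits it as the antisymmetrisation in \<open>a\<close>, \<open>b\<close> of a single expression.\<close>

definition curvature_form :: "'n::finite metric \<Rightarrow> real^'n \<Rightarrow> real^'n \<Rightarrow> real^'n \<Rightarrow> real^'n \<Rightarrow> real^'n" where
  "curvature_form g p a b c =
     (christoffel_deriv g p a b c + christoffel_form g p a (christoffel_form g p b c))
     - (christoffel_deriv g p b a c + christoffel_form g p b (christoffel_form g p a c))"

lemma curvature_form_nth:
  "curvature_form g p a b c $ l =
     (\<Sum>i\<in>UNIV. \<Sum>j\<in>UNIV. \<Sum>k\<in>UNIV. a $ i * (b $ j * (c $ k * curvature_op g p i j k l)))"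
proof -
  have 1: "christoffel_deriv g p a b c $ l
     = (\<Sum>i\<in>UNIV. \<Sum>j\<in>UNIV. \<Sum>k\<in>UNIV. a $ i * (b $ j * (c $ k * partial i (\<lambda>q. christoffel g q j k l) p)))"
    for a b
  proof -
    have "christoffel_deriv g p a b c $ l
      = (\<Sum>j\<in>UNIV. \<Sum>k\<in>UNIV. \<Sum>i\<in>UNIV. a $ i * (b $ j * (c $ k * partial i (\<lambda>q. christoffel g q j k l) p)))"
      by (simp add: christoffel_deriv_def tensor_eval_pair christoffel_field_def dir_deriv_def sum_distrib_left mult_ac)
    also have "\<dots> = (\<Sum>j\<in>UNIV. \<Sum>i\<in>UNIV. \<Sum>k\<in>UNIV. a $ i * (b $ j * (c $ k * partial i (\<lambda>q. christoffel g q j k l) p)))"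
      by (intro sum.cong refl sum.swap)
    finally show ?thesis by (subst (asm) sum.swap)
  qed
  have 2: "christoffel_form g p a (christoffel_form g p b c) $ l
     = (\<Sum>i\<in>UNIV. \<Sum>j\<in>UNIV. \<Sum>k\<in>UNIV. a $ i * (b $ j * (c $ k * (\<Sum>m\<in>UNIV. christoffel g p j k m * christoffel g p i m l))))"
    for a b
  proof -
    have "christoffel_form g p a (christoffel_form g p b c) $ l
      = (\<Sum>i\<in>UNIV. \<Sum>m\<in>UNIV. \<Sum>j\<in>UNIV. \<Sum>k\<in>UNIV. a $ i * (b $ j * (c $ k * (christoffel g p j k m * christoffel g p i m l))))"
      by (simp add: christoffel_form_def sum_distrib_left sum_distrib_right mult_ac)
    also have "\<dots> = (\<Sum>i\<in>UNIV. \<Sum>j\<in>UNIV. \<Sum>m\<in>UNIV. \<Sum>k\<in>UNIV. a $ i * (b $ j * (c $ k * (christoffel g p j k m * christoffel g p i m l))))"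
      by (intro sum.cong refl sum.swap)
    also have "\<dots> = (\<Sum>i\<in>UNIV. \<Sum>j\<in>UNIV. \<Sum>k\<in>UNIV. \<Sum>m\<in>UNIV. a $ i * (b $ j * (c $ k * (christoffel g p j k m * christoffel g p i m l))))"
      by (intro sum.cong refl sum.swap)
    finally show ?thesis by (simp only: sum_distrib_left)
  qed
  have flip: "(\<Sum>i\<in>UNIV. \<Sum>j\<in>UNIV. \<Sum>k\<in>UNIV. b $ i * (a $ j * (c $ k * H i j k)))
     = (\<Sum>i\<in>UNIV. \<Sum>j\<in>UNIV. \<Sum>k\<in>UNIV. a $ i * (b $ j * (c $ k * H j i k)))" for H :: "'a \<Rightarrow> 'a \<Rightarrow> 'a \<Rightarrow> real"
    by (subst sum.swap) (simp add: mult.left_commute)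
  show ?thesis
    unfolding curvature_form_def vector_minus_component vector_add_component 1 2 flip
    by (simp add: curvature_op_def sum.distrib sum_subtractf algebra_simps)
qed

lemma tensor_eval_curvature:
  "tensor_eval (nabla_R g 0) p [a, b, c, d] = metric_form g p (curvature_form g p a b c) d"
proof -
  let ?t = "\<lambda>i j k l m. a $ i * (b $ j * (c $ k * (d $ l * (curvature_op g p i j k m * g p $ m $ l))))"
  have "metric_form g p (curvature_form g p a b c) d
      = (\<Sum>m\<in>UNIV. \<Sum>l\<in>UNIV. \<Sum>i\<in>UNIV. \<Sum>j\<in>UNIV. \<Sum>k\<in>UNIV. ?t i j k l m)"
    by (simp add: metric_form_eq tensor_eval_pair metric_field_def curvature_form_nth sum_distrib_left
        sum_distrib_right mult_ac)
  also have "\<dots> = (\<Sum>l\<in>UNIV. \<Sum>m\<in>UNIV. \<Sum>i\<in>UNIV. \<Sum>j\<in>UNIV. \<Sum>k\<in>UNIV. ?t i j k l m)"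
    by (rule sum.swap)
  also have "\<dots> = (\<Sum>l\<in>UNIV. \<Sum>i\<in>UNIV. \<Sum>m\<in>UNIV. \<Sum>j\<in>UNIV. \<Sum>k\<in>UNIV. ?t i j k l m)"
    by (intro sum.cong refl sum.swap)
  also have "\<dots> = (\<Sum>i\<in>UNIV. \<Sum>l\<in>UNIV. \<Sum>m\<in>UNIV. \<Sum>j\<in>UNIV. \<Sum>k\<in>UNIV. ?t i j k l m)"
    by (rule sum.swap)
  also have "\<dots> = (\<Sum>i\<in>UNIV. \<Sum>l\<in>UNIV. \<Sum>j\<in>UNIV. \<Sum>m\<in>UNIV. \<Sum>k\<in>UNIV. ?t i j k l m)"
    by (intro sum.cong refl sum.swap)
  also have "\<dots> = (\<Sum>i\<in>UNIV. \<Sum>j\<in>UNIV. \<Sum>l\<in>UNIV. \<Sum>m\<in>UNIV. \<Sum>k\<in>UNIV. ?t i j k l m)"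
    by (intro sum.cong refl sum.swap)
  also have "\<dots> = (\<Sum>i\<in>UNIV. \<Sum>j\<in>UNIV. \<Sum>l\<in>UNIV. \<Sum>k\<in>UNIV. \<Sum>m\<in>UNIV. ?t i j k l m)"
    by (intro sum.cong refl sum.swap)
  also have "\<dots> = (\<Sum>i\<in>UNIV. \<Sum>j\<in>UNIV. \<Sum>k\<in>UNIV. \<Sum>l\<in>UNIV. \<Sum>m\<in>UNIV. ?t i j k l m)"
    by (intro sum.cong refl sum.swap)
  also have "\<dots> = tensor_eval (nabla_R g 0) p [a, b, c, d]"
    by (simp add: tensor_eval_Cons_Nil curvature_def sum_distrib_left numeral_2_eq_2 numeral_3_eq_3)
  finally show ?thesis ..
qed

lemma metric_form_add_left: "metric_form g p (u + v) w = metric_form g p u w + metric_form g p v w"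
  by (simp add: metric_form_def inner_add_left)

lemma metric_form_diff_left: "metric_form g p (u - v) w = metric_form g p u w - metric_form g p v w"
  by (simp add: metric_form_def inner_diff_left)

lemma metric_form_commute:
  assumes "pseudo_riemannian g"
  shows "metric_form g p v w = metric_form g p w v"
proof -
  have "g p $ i $ j = g p $ j $ i" for i j
    using assms unfolding pseudo_riemannian_def transpose_def vec_eq_iff by (metis vec_lambda_beta)
  then show ?thesis
    unfolding metric_form_eq tensor_eval_pair metric_field_def
    by (subst sum.swap) (simp add: mult.left_commute)
qed

lemma metric_form_nondegenerate:
  assumes "pseudo_riemannian g" "\<And>w. metric_form g p v w = 0"
  shows "v = 0"
proof -
  have "metric_form g p w v = 0" for w
    using assms metric_form_commute by metis
  then have "g p *v v = 0" unfolding metric_form_def by (metis inner_eq_zero_iff)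
  moreover have "invertible (g p)" using assms by (simp add: pseudo_riemannian_def)
  ultimately show ?thesis
    by (metis invertible_def matrix_left_invertible_ker)
qed

lemma metric_inverse:
  assumes "pseudo_riemannian g"
  shows "(\<Sum>k\<in>UNIV. matrix_inv (g p) $ k $ l * g p $ k $ m) = (if l = m then 1 else 0)"
proof -
  have "invertible (g p)" using assms by (simp add: pseudo_riemannian_def)
  then have "g p ** matrix_inv (g p) = mat 1"
    unfolding invertible_def matrix_inv_def by (rule someI2_ex) simp
  then have "(\<Sum>k\<in>UNIV. g p $ m $ k * matrix_inv (g p) $ k $ l) = (if m = l then 1 else 0)"
    unfolding matrix_matrix_mult_def mat_def vec_eq_iff by simp
  moreover have "g p $ m $ k = g p $ k $ m" for k
    using assms unfolding pseudo_riemannian_def transpose_def vec_eq_iff by (metis vec_lambda_beta)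
  ultimately show ?thesis by (simp add: mult.commute eq_commute)
qed

abbreviation metric_deriv :: "'n::finite metric \<Rightarrow> real^'n \<Rightarrow> real^'n \<Rightarrow> real^'n \<Rightarrow> real^'n \<Rightarrow> real" where
  "metric_deriv g p u v w \<equiv> tensor_eval (directional_tensor (metric_field g) u) p [v, w]"

lemma metric_deriv_eq:
  "metric_deriv g p u v w
    = (\<Sum>i\<in>UNIV. \<Sum>j\<in>UNIV. \<Sum>l\<in>UNIV. u $ i * (v $ j * (w $ l * partial i (\<lambda>q. g q $ j $ l) p)))"
proof -
  have "metric_deriv g p u v w
     = (\<Sum>j\<in>UNIV. \<Sum>l\<in>UNIV. \<Sum>i\<in>UNIV. u $ i * (v $ j * (w $ l * partial i (\<lambda>q. g q $ j $ l) p)))"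
    by (simp add: tensor_eval_pair dir_deriv_def metric_field_def sum_distrib_left mult_ac)
  also have "\<dots> = (\<Sum>j\<in>UNIV. \<Sum>i\<in>UNIV. \<Sum>l\<in>UNIV. u $ i * (v $ j * (w $ l * partial i (\<lambda>q. g q $ j $ l) p)))"
    by (intro sum.cong refl sum.swap)
  finally show ?thesis by (subst (asm) sum.swap)
qed

lemma lowered_christoffel:
  assumes "pseudo_riemannian g"
  shows "(\<Sum>k\<in>UNIV. christoffel g p i j k * g p $ k $ m)
    = 1/2 * (partial i (\<lambda>q. g q $ j $ m) p + partial j (\<lambda>q. g q $ i $ m) p - partial m (\<lambda>q. g q $ i $ j) p)"
proof -
  let ?K = "\<lambda>l. partial i (\<lambda>q. g q $ j $ l) p + partial j (\<lambda>q. g q $ i $ l) p - partial l (\<lambda>q. g q $ i $ j) p"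
  have "(\<Sum>k\<in>UNIV. christoffel g p i j k * g p $ k $ m)
      = (\<Sum>k\<in>UNIV. \<Sum>l\<in>UNIV. 1/2 * ?K l * (matrix_inv (g p) $ k $ l * g p $ k $ m))"
    unfolding christoffel_def sum_distrib_left sum_distrib_right by (intro sum.cong refl) (simp add: mult_ac)
  also have "\<dots> = (\<Sum>l\<in>UNIV. 1/2 * ?K l * (\<Sum>k\<in>UNIV. matrix_inv (g p) $ k $ l * g p $ k $ m))"
    by (subst sum.swap) (simp only: sum_distrib_left)
  also have "\<dots> = 1/2 * ?K m"
    unfolding metric_inverse[OF assms] by (simp add: if_distrib cong: if_cong)
  finally show ?thesis .
qed

text \<open>The Koszul formula for fields with constant components: contracting with the metric cancels the inverse
  metric in the Christoffel symbols.\<close>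

lemma koszul:
  assumes "pseudo_riemannian g"
  shows "metric_form g p (christoffel_form g p v w) u
    = 1/2 * (metric_deriv g p v w u + metric_deriv g p w v u - metric_deriv g p u v w)"
proof -
  let ?t = "\<lambda>i j m x. v $ i * (w $ j * (u $ m * x))"
  have "metric_form g p (christoffel_form g p v w) u
      = (\<Sum>k\<in>UNIV. \<Sum>m\<in>UNIV. \<Sum>i\<in>UNIV. \<Sum>j\<in>UNIV. ?t i j m (christoffel g p i j k * g p $ k $ m))"
    by (simp add: metric_form_eq tensor_eval_pair metric_field_def christoffel_form_def sum_distrib_left
        sum_distrib_right mult_ac)
  also have "\<dots> = (\<Sum>k\<in>UNIV. \<Sum>i\<in>UNIV. \<Sum>m\<in>UNIV. \<Sum>j\<in>UNIV. ?t i j m (christoffel g p i j k * g p $ k $ m))"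
    by (intro sum.cong refl sum.swap)
  also have "\<dots> = (\<Sum>i\<in>UNIV. \<Sum>k\<in>UNIV. \<Sum>m\<in>UNIV. \<Sum>j\<in>UNIV. ?t i j m (christoffel g p i j k * g p $ k $ m))"
    by (rule sum.swap)
  also have "\<dots> = (\<Sum>i\<in>UNIV. \<Sum>k\<in>UNIV. \<Sum>j\<in>UNIV. \<Sum>m\<in>UNIV. ?t i j m (christoffel g p i j k * g p $ k $ m))"
    by (intro sum.cong refl sum.swap)
  also have "\<dots> = (\<Sum>i\<in>UNIV. \<Sum>j\<in>UNIV. \<Sum>k\<in>UNIV. \<Sum>m\<in>UNIV. ?t i j m (christoffel g p i j k * g p $ k $ m))"
    by (intro sum.cong refl sum.swap)
  also have "\<dots> = (\<Sum>i\<in>UNIV. \<Sum>j\<in>UNIV. \<Sum>m\<in>UNIV. \<Sum>k\<in>UNIV. ?t i j m (christoffel g p i j k * g p $ k $ m))"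
    by (intro sum.cong refl sum.swap)
  also have "\<dots> = (\<Sum>i\<in>UNIV. \<Sum>j\<in>UNIV. \<Sum>m\<in>UNIV. ?t i j m (1/2 * (partial i (\<lambda>q. g q $ j $ m) p
        + partial j (\<lambda>q. g q $ i $ m) p - partial m (\<lambda>q. g q $ i $ j) p)))"
    by (simp only: lowered_christoffel[OF assms] sum_distrib_left[symmetric])
  also have "\<dots> = 1/2 * ((\<Sum>i\<in>UNIV. \<Sum>j\<in>UNIV. \<Sum>m\<in>UNIV. ?t i j m (partial i (\<lambda>q. g q $ j $ m) p))
      + (\<Sum>i\<in>UNIV. \<Sum>j\<in>UNIV. \<Sum>m\<in>UNIV. ?t i j m (partial j (\<lambda>q. g q $ i $ m) p))
      - (\<Sum>i\<in>UNIV. \<Sum>j\<in>UNIV. \<Sum>m\<in>UNIV. ?t i j m (partial m (\<lambda>q. g q $ i $ j) p)))"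
    by (simp only: right_diff_distrib distrib_left sum.distrib sum_subtractf sum_distrib_left
        mult.left_commute[of _ "1/2"])
  also have "(\<Sum>i\<in>UNIV. \<Sum>j\<in>UNIV. \<Sum>m\<in>UNIV. ?t i j m (partial i (\<lambda>q. g q $ j $ m) p)) = metric_deriv g p v w u"
    by (simp add: metric_deriv_eq)
  also have "(\<Sum>i\<in>UNIV. \<Sum>j\<in>UNIV. \<Sum>m\<in>UNIV. ?t i j m (partial j (\<lambda>q. g q $ i $ m) p)) = metric_deriv g p w v u"
    unfolding metric_deriv_eq by (subst sum.swap) (simp add: mult.left_commute)
  also have "(\<Sum>i\<in>UNIV. \<Sum>j\<in>UNIV. \<Sum>m\<in>UNIV. ?t i j m (partial m (\<lambda>q. g q $ i $ j) p)) = metric_deriv g p u v w"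
  proof -
    have "(\<Sum>i\<in>UNIV. \<Sum>j\<in>UNIV. \<Sum>m\<in>UNIV. ?t i j m (partial m (\<lambda>q. g q $ i $ j) p))
        = (\<Sum>i\<in>UNIV. \<Sum>m\<in>UNIV. \<Sum>j\<in>UNIV. ?t i j m (partial m (\<lambda>q. g q $ i $ j) p))"
      by (intro sum.cong refl sum.swap)
    then show ?thesis unfolding metric_deriv_eq
      by (subst (asm) sum.swap) (simp add: mult_ac)
  qed
  finally show ?thesis .
qed

section \<open>Isometries preserve curvature and its covariant derivatives\<close>

text \<open>The differentiability that the chain rule calls for when the metric, the connection and the successive
  derivatives of curvature are compared along an isometry.\<close>

definition smooth_geometry :: "'n::finite metric \<Rightarrow> bool" where
  "smooth_geometry g \<longleftrightarrow> pseudo_riemannian g \<and>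
     (\<forall>p i j k. (\<lambda>q. christoffel g q i j k) differentiable at p) \<and>
     (\<forall>k p is. (\<lambda>q. nabla_R g k q is) differentiable at p)"

locale local_isometry =
  fixes g\<^sub>1 g\<^sub>2 :: "'n::finite metric" and U :: "(real^'n) set" and \<phi> :: "real^'n \<Rightarrow> real^'n"
  assumes geom1: "smooth_geometry g\<^sub>1" and geom2: "smooth_geometry g\<^sub>2"
    and open_U: "open U" and smooth: "smooth_map_on U \<phi>"
    and pullback: "\<And>p v w. p \<in> U \<Longrightarrow>
      metric_form g\<^sub>2 (\<phi> p) (differential \<phi> p v) (differential \<phi> p w) = metric_form g\<^sub>1 p v w"
begin

abbreviation "J \<equiv> differential \<phi>"
abbreviation "H \<equiv> second_differential \<phi>"
abbreviation "\<Gamma>\<^sub>1 \<equiv> christoffel_form g\<^sub>1"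
abbreviation "\<Gamma>\<^sub>2 \<equiv> christoffel_form g\<^sub>2"

lemma pr1: "pseudo_riemannian g\<^sub>1" and pr2: "pseudo_riemannian g\<^sub>2"
  using geom1 geom2 by (simp_all add: smooth_geometry_def)

lemma metric_field_differentiable: "pseudo_riemannian g \<Longrightarrow> (\<lambda>q. metric_field g q is) differentiable at p"
  unfolding pseudo_riemannian_def metric_field_def by (blast intro: smooth_on_differentiable)

lemma inj_differential: "p \<in> U \<Longrightarrow> inj (J p)"
  unfolding linear_injective_0[OF linear_differential]
proof (intro allI impI)
  fix v assume "p \<in> U" "J p v = 0"
  then have "metric_form g\<^sub>1 p v w = 0" for w
    using pullback[of p v w] by (simp add: metric_form_def)
  then show "v = 0" by (rule metric_form_nondegenerate[OF pr1])
qed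

lemma surj_differential: "p \<in> U \<Longrightarrow> surj (J p)"
  using inj_differential linear_differential linear_injective_imp_surjective by blast

text \<open>The derivative of \<open>\<phi>\<^sup>* g\<^sub>2 = g\<^sub>1\<close> in the direction \<open>u\<close>.\<close>

lemma pullback_metric_deriv:
  assumes p: "p \<in> U"
  shows "metric_deriv g\<^sub>2 (\<phi> p) (J p u) (J p v) (J p w)
      + (metric_form g\<^sub>2 (\<phi> p) (H p u v) (J p w) + metric_form g\<^sub>2 (\<phi> p) (J p v) (H p u w))
    = metric_deriv g\<^sub>1 p u v w"
proof -
  have D2: "((\<lambda>q. tensor_eval (metric_field g\<^sub>2) (\<phi> q) [J q v, J q w]) has_derivative
     (\<lambda>u. metric_deriv g\<^sub>2 (\<phi> p) (J p u) (J p v) (J p w)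
      + (metric_form g\<^sub>2 (\<phi> p) (H p u v) (J p w) + metric_form g\<^sub>2 (\<phi> p) (J p v) (H p u w)))) (at p)"
    unfolding metric_form_eq
    by (intro has_derivative_tensor_eval_pair metric_field_differentiable[OF pr2]
        has_derivative_differential[OF smooth p] has_derivative_second_differential[OF smooth p])
  have D1: "((\<lambda>q. tensor_eval (metric_field g\<^sub>1) q [v, w]) has_derivative (\<lambda>u. metric_deriv g\<^sub>1 p u v w)) (at p)"
    by (intro has_derivative_tensor_eval_const metric_field_differentiable[OF pr1])
  have "((\<lambda>q. tensor_eval (metric_field g\<^sub>2) (\<phi> q) [J q v, J q w]) has_derivative
      (\<lambda>u. metric_deriv g\<^sub>1 p u v w)) (at p)"
    by (rule has_derivative_transform_within_open[OF D1 open_U p])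
       (simp add: pullback metric_form_eq[symmetric])
  from has_derivative_unique[OF D2 this] show ?thesis by meson
qed

text \<open>Cyclic combination of the differentiated identity \<open>\<phi>\<^sup>* g\<^sub>2 = g\<^sub>1\<close>, as in the Koszul formula, leaves a
  single second derivative of \<open>\<phi>\<close>, because those are symmetric. Nondegeneracy of \<open>g\<^sub>2\<close> and surjectivity
  of the differential then remove the test vector.\<close>

lemma christoffel_transformation:
  assumes p: "p \<in> U"
  shows "J p (\<Gamma>\<^sub>1 p v w) = H p v w + \<Gamma>\<^sub>2 (\<phi> p) (J p v) (J p w)"
proof -
  have "metric_form g\<^sub>2 (\<phi> p) (J p (\<Gamma>\<^sub>1 p v w) - (H p v w + \<Gamma>\<^sub>2 (\<phi> p) (J p v) (J p w))) x = 0" for x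
  proof -
    obtain u where x: "x = J p u" using surj_differential[OF p] by (meson surjD)
    note m = pullback_metric_deriv[OF p] and c = metric_form_commute[OF pr2]
    have "metric_form g\<^sub>2 (\<phi> p) (J p (\<Gamma>\<^sub>1 p v w)) (J p u)
        = 1/2 * (metric_deriv g\<^sub>1 p v w u + metric_deriv g\<^sub>1 p w v u - metric_deriv g\<^sub>1 p u v w)"
      by (simp only: pullback[OF p] koszul[OF pr1])
    moreover have "metric_form g\<^sub>2 (\<phi> p) (\<Gamma>\<^sub>2 (\<phi> p) (J p v) (J p w)) (J p u)
        = 1/2 * (metric_deriv g\<^sub>2 (\<phi> p) (J p v) (J p w) (J p u) + metric_deriv g\<^sub>2 (\<phi> p) (J p w) (J p v) (J p u)
            - metric_deriv g\<^sub>2 (\<phi> p) (J p u) (J p v) (J p w))"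
      by (rule koszul[OF pr2])
    ultimately show ?thesis
      unfolding x metric_form_diff_left metric_form_add_left
      using m[of v w u] m[of w v u] m[of u v w] c[of "\<phi> p" "J p v" "H p u w"] c[of "\<phi> p" "J p w" "H p v u"]
        c[of "\<phi> p" "J p v" "H p w u"]
        second_differential_commute[OF smooth open_U p, of v w] second_differential_commute[OF smooth open_U p, of u v]
        second_differential_commute[OF smooth open_U p, of u w]
      by (simp only:) argo
  qed
  then show ?thesis
    using metric_form_nondegenerate[OF pr2] by (metis eq_iff_diff_eq_0)
qed

lemma christoffel_field_differentiable:
  "smooth_geometry g \<Longrightarrow> (\<lambda>q. christoffel_field g k q is) differentiable at p"
  unfolding smooth_geometry_def christoffel_field_def by blast

text \<open>Both sides of the transformation law of the Christoffel symbols, differentiated in the direction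
  \<open>u\<close>.\<close>

lemma christoffel_deriv_transformation:
  assumes p: "p \<in> U"
  shows "J p (christoffel_deriv g\<^sub>1 p u v w) + H p u (\<Gamma>\<^sub>1 p v w)
    = third_differential \<phi> p u v w + (christoffel_deriv g\<^sub>2 (\<phi> p) (J p u) (J p v) (J p w)
        + (\<Gamma>\<^sub>2 (\<phi> p) (H p u v) (J p w) + \<Gamma>\<^sub>2 (\<phi> p) (J p v) (H p u w)))"
proof -
  have "((\<lambda>q. \<Gamma>\<^sub>1 q v w) has_derivative (\<lambda>u. christoffel_deriv g\<^sub>1 p u v w)) (at p)"
    unfolding has_derivative_vec_nth_iff christoffel_form_eq christoffel_deriv_def vec_lambda_beta
    by (intro allI has_derivative_tensor_eval_const christoffel_field_differentiable[OF geom1])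
  then have D1: "((\<lambda>q. J q (\<Gamma>\<^sub>1 q v w)) has_derivative
      (\<lambda>u. J p (christoffel_deriv g\<^sub>1 p u v w) + H p u (\<Gamma>\<^sub>1 p v w))) (at p)"
    by (rule has_derivative_differential_apply[OF smooth p])
  have "((\<lambda>q. \<Gamma>\<^sub>2 (\<phi> q) (J q v) (J q w)) has_derivative
     (\<lambda>u. christoffel_deriv g\<^sub>2 (\<phi> p) (J p u) (J p v) (J p w)
        + (\<Gamma>\<^sub>2 (\<phi> p) (H p u v) (J p w) + \<Gamma>\<^sub>2 (\<phi> p) (J p v) (H p u w)))) (at p)"
    unfolding has_derivative_vec_nth_iff vector_add_component christoffel_form_eq christoffel_deriv_def vec_lambda_beta
    by (intro allI has_derivative_tensor_eval_pair christoffel_field_differentiable[OF geom2]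
        has_derivative_differential[OF smooth p] has_derivative_second_differential[OF smooth p])
  then have "((\<lambda>q. H q v w + \<Gamma>\<^sub>2 (\<phi> q) (J q v) (J q w)) has_derivative
     (\<lambda>u. third_differential \<phi> p u v w + (christoffel_deriv g\<^sub>2 (\<phi> p) (J p u) (J p v) (J p w)
        + (\<Gamma>\<^sub>2 (\<phi> p) (H p u v) (J p w) + \<Gamma>\<^sub>2 (\<phi> p) (J p v) (H p u w))))) (at p)"
    by (intro has_derivative_add has_derivative_third_differential[OF smooth open_U p])
  then have "((\<lambda>q. J q (\<Gamma>\<^sub>1 q v w)) has_derivative
     (\<lambda>u. third_differential \<phi> p u v w + (christoffel_deriv g\<^sub>2 (\<phi> p) (J p u) (J p v) (J p w)
        + (\<Gamma>\<^sub>2 (\<phi> p) (H p u v) (J p w) + \<Gamma>\<^sub>2 (\<phi> p) (J p v) (H p u w))))) (at p)"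
    by (rule has_derivative_transform_within_open[OF _ open_U p]) (simp add: christoffel_transformation)
  from has_derivative_unique[OF D1 this] show ?thesis by meson
qed

text \<open>After the second derivatives of \<open>\<phi>\<close> at Christoffel vectors are eliminated by the transformation law,
  every remaining term that contains derivatives of \<open>\<phi>\<close> of order two or three is symmetric in \<open>u\<close>, \<open>v\<close>, and
  so disappears in the antisymmetrisation.\<close>

lemma curvature_form_transformation:
  assumes p: "p \<in> U"
  shows "J p (curvature_form g\<^sub>1 p u v w) = curvature_form g\<^sub>2 (\<phi> p) (J p u) (J p v) (J p w)"
proof -
  have "J p (christoffel_deriv g\<^sub>1 p u v w + \<Gamma>\<^sub>1 p u (\<Gamma>\<^sub>1 p v w))
     = (third_differential \<phi> p u v w + \<Gamma>\<^sub>2 (\<phi> p) (H p u v) (J p w)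
        + (\<Gamma>\<^sub>2 (\<phi> p) (J p v) (H p u w) + \<Gamma>\<^sub>2 (\<phi> p) (J p u) (H p v w)))
       + (christoffel_deriv g\<^sub>2 (\<phi> p) (J p u) (J p v) (J p w)
          + \<Gamma>\<^sub>2 (\<phi> p) (J p u) (\<Gamma>\<^sub>2 (\<phi> p) (J p v) (J p w)))" for u v
    using christoffel_deriv_transformation[OF p, of u v w]
      christoffel_transformation[OF p, of u "\<Gamma>\<^sub>1 p v w"] christoffel_transformation[OF p, of v w]
    by (simp add: differential_add christoffel_form_add_right algebra_simps)
  then show ?thesis
    unfolding curvature_form_def differential_diff
    by (simp add: third_differential_commute[OF smooth open_U p, of u v]
        second_differential_commute[OF smooth open_U p, of u v] add_ac)
qed

text \<open>Differentiating \<open>\<phi>\<^sup>* T\<^sub>2 = T\<^sub>1\<close> produces second derivatives of \<open>\<phi>\<close> in each slot; these are exactly the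
  inhomogeneous terms in the transformation law of the Christoffel symbols.\<close>

lemma cov_deriv_transformation:
  assumes p: "p \<in> U"
    and T1: "\<And>is. (\<lambda>q. T\<^sub>1 q is) differentiable at p"
    and T2: "\<And>is. (\<lambda>q. T\<^sub>2 q is) differentiable at (\<phi> p)"
    and T: "\<And>q vs. q \<in> U \<Longrightarrow> length vs = n \<Longrightarrow> tensor_eval T\<^sub>2 (\<phi> q) (map (J q) vs) = tensor_eval T\<^sub>1 q vs"
    and len: "length us = Suc n"
  shows "tensor_eval (cov_deriv g\<^sub>2 T\<^sub>2) (\<phi> p) (map (J p) us) = tensor_eval (cov_deriv g\<^sub>1 T\<^sub>1) p us"
proof -
  obtain vs w where us: "us = vs @ [w]" and n: "length vs = n"
    using len by (metis length_Suc_conv_rev)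
  let ?Js = "map (J p) vs"
  have D2: "((\<lambda>q. tensor_eval T\<^sub>2 (\<phi> q) (map (\<lambda>X. X q) (map (\<lambda>v q. J q v) vs))) has_derivative
     (\<lambda>u. tensor_eval (directional_tensor T\<^sub>2 (J p u)) (\<phi> p) (map (\<lambda>X. X p) (map (\<lambda>v q. J q v) vs))
        + (\<Sum>s<length (map (\<lambda>v q. J q v) vs).
            tensor_eval T\<^sub>2 (\<phi> p) ((map (\<lambda>X. X p) (map (\<lambda>v q. J q v) vs))[s := H p u (vs ! s)])))) (at p)"
    by (rule has_derivative_tensor_eval)
       (auto intro: T2 has_derivative_differential[OF smooth p] has_derivative_second_differential[OF smooth p])
  have D1: "((\<lambda>q. tensor_eval T\<^sub>1 q vs) has_derivative
     (\<lambda>u. tensor_eval (directional_tensor T\<^sub>1 u) p vs)) (at p)"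
    by (intro has_derivative_tensor_eval_const T1)
  have "((\<lambda>q. tensor_eval T\<^sub>2 (\<phi> q) (map (\<lambda>X. X q) (map (\<lambda>v q. J q v) vs))) has_derivative
     (\<lambda>u. tensor_eval (directional_tensor T\<^sub>1 u) p vs)) (at p)"
    by (rule has_derivative_transform_within_open[OF D1 open_U p]) (simp add: T n comp_def)
  from has_derivative_unique[OF D2 this]
  have deriv: "tensor_eval (directional_tensor T\<^sub>2 (J p w)) (\<phi> p) ?Js
      + (\<Sum>s<n. tensor_eval T\<^sub>2 (\<phi> p) (?Js[s := H p w (vs ! s)]))
    = tensor_eval (directional_tensor T\<^sub>1 w) p vs"
    by (auto simp: n comp_def dest: fun_cong[where x = w])
  have conn: "(\<Sum>s<n. tensor_eval T\<^sub>1 p (vs[s := \<Gamma>\<^sub>1 p w (vs ! s)]))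
     = (\<Sum>s<n. tensor_eval T\<^sub>2 (\<phi> p) (?Js[s := H p w (vs ! s)]))
      + (\<Sum>s<n. tensor_eval T\<^sub>2 (\<phi> p) (?Js[s := \<Gamma>\<^sub>2 (\<phi> p) (J p w) (J p (vs ! s))]))"
    unfolding sum.distrib[symmetric]
  proof (intro sum.cong refl)
    fix s assume "s \<in> {..<n}"
    then have s: "s < length ?Js" using n by simp
    have "tensor_eval T\<^sub>1 p (vs[s := \<Gamma>\<^sub>1 p w (vs ! s)]) = tensor_eval T\<^sub>2 (\<phi> p) (?Js[s := J p (\<Gamma>\<^sub>1 p w (vs ! s))])"
      using T[OF p, of "vs[s := \<Gamma>\<^sub>1 p w (vs ! s)]"] n by (simp add: map_update)
    then show "tensor_eval T\<^sub>1 p (vs[s := \<Gamma>\<^sub>1 p w (vs ! s)])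
      = tensor_eval T\<^sub>2 (\<phi> p) (?Js[s := H p w (vs ! s)])
        + tensor_eval T\<^sub>2 (\<phi> p) (?Js[s := \<Gamma>\<^sub>2 (\<phi> p) (J p w) (J p (vs ! s))])"
      by (simp only: christoffel_transformation[OF p] tensor_eval_update_add[OF s])
  qed
  show ?thesis
    using deriv conn by (simp add: us tensor_eval_cov_deriv n)
qed

theorem nabla_R_transformation:
  assumes "p \<in> U" "length vs = 4 + k"
  shows "tensor_eval (nabla_R g\<^sub>2 k) (\<phi> p) (map (J p) vs) = tensor_eval (nabla_R g\<^sub>1 k) p vs"
  using assms
proof (induction k arbitrary: p vs)
  case 0
  then obtain a b c d where "vs = [a, b, c, d]"
    by (auto simp: length_Suc_conv numeral_eq_Suc)
  then show ?case
    using 0 by (simp only: list.map tensor_eval_curvature curvature_form_transformation[symmetric] pullback)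
next
  case (Suc k)
  have "(\<lambda>q. nabla_R g\<^sub>1 k q is) differentiable at p" "(\<lambda>q. nabla_R g\<^sub>2 k q is) differentiable at (\<phi> p)" for "is"
    using geom1 geom2 by (simp_all add: smooth_geometry_def)
  then show ?case
    using Suc unfolding nabla_R.simps by (intro cov_deriv_transformation[of _ _ _ "4 + k"]) auto
qed

theorem model_isomorphism_differential:
  assumes "p \<in> U"
  shows "model_isomorphism k g\<^sub>1 p g\<^sub>2 (\<phi> p) (J p)"
  unfolding model_isomorphism_def
  using assms linear_differential inj_differential surj_differential pullback nabla_R_transformation
  by (simp add: bij_def)

end

theorem isometry_imp_models_isomorphic:
  assumes "smooth_geometry g\<^sub>1" "smooth_geometry g\<^sub>2" and iso: "isometry_between g\<^sub>1 U g\<^sub>2 V \<phi>" and p: "p \<in> U"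
  shows "models_isomorphic k g\<^sub>1 p g\<^sub>2 (\<phi> p)"
proof -
  have "frechet_derivative \<phi> (at q) = differential \<phi> q" if "q \<in> U" for q
    using iso that has_derivative_differential[of U \<phi> q] frechet_derivative_at[of \<phi> "differential \<phi> q" q]
    unfolding isometry_between_def by auto
  then interpret local_isometry g\<^sub>1 g\<^sub>2 U \<phi>
    using assms(1,2) iso by unfold_locales (auto simp: isometry_between_def)
  show ?thesis
    using model_isomorphism_differential[OF p] unfolding models_isomorphic_def by blast
qed

section \<open>Christoffel symbols and curvature of the six-dimensional family\<close>

lemma UNIV_coord: "(UNIV :: coord set) = {Cx, Cy, Cz1, Cz2, Cyt, Cxt}"
  using coord.exhaust by auto

lemma sum_coord: "(\<Sum>i\<in>UNIV. F i) = F Cx + F Cy + F Cz1 + F Cz2 + F Cyt + F Cxt" for F :: "coord \<Rightarrow> real"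
  by (simp add: UNIV_coord add_ac)

definition potential :: "(real \<Rightarrow> real) \<Rightarrow> real^coord \<Rightarrow> real" where
  "potential f p = p $ Cy * p $ Cz1 + f (p $ Cy) * p $ Cz2"

definition potential_grad :: "(real \<Rightarrow> real) \<Rightarrow> real^coord \<Rightarrow> coord \<Rightarrow> real" where
  "potential_grad f p i = (case i of Cy \<Rightarrow> p $ Cz1 + deriv f (p $ Cy) * p $ Cz2 | Cz1 \<Rightarrow> p $ Cy | Cz2 \<Rightarrow> f (p $ Cy) | _ \<Rightarrow> 0)"

definition potential_hess :: "(real \<Rightarrow> real) \<Rightarrow> real^coord \<Rightarrow> coord \<Rightarrow> coord \<Rightarrow> real" where
  "potential_hess f p i j =
    (if i = Cy \<and> j = Cy then deriv (deriv f) (p $ Cy) * p $ Cz2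
     else if (i, j) \<in> {(Cy, Cz1), (Cz1, Cy)} then 1
     else if (i, j) \<in> {(Cy, Cz2), (Cz2, Cy)} then deriv f (p $ Cy)
     else 0)"

lemma smooth_real_DERIV:
  assumes "smooth_real f"
  shows "DERIV ((deriv ^^ k) f) x :> (deriv ^^ Suc k) f x"
  using assms unfolding smooth_real_def
  by (simp add: DERIV_deriv_iff_real_differentiable)

lemma has_derivative_coord: "((\<lambda>p::real^'n. p $ i) has_derivative (\<lambda>u. u $ i)) (at p)"
  by (intro bounded_linear_imp_has_derivative bounded_linear_vec_nth)

text \<open>Stated for all orders at once: \<open>f\<close>, \<open>f'\<close> and \<open>f''\<close> enter the potential, its gradient and its
  Hessian.\<close>

lemma has_derivative_deriv_y:
  assumes "smooth_real f"
  shows "((\<lambda>p::real^coord. (deriv ^^ k) f (p $ Cy)) has_derivative (\<lambda>u. (deriv ^^ Suc k) f (p $ Cy) * u $ Cy)) (at p)"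
proof -
  have "((\<lambda>p::real^coord. p $ Cy) has_derivative (\<lambda>u. u $ Cy)) (at p)"
    by (rule has_derivative_coord)
  from has_derivative_compose[OF this smooth_real_DERIV[OF assms, unfolded has_field_derivative_def]]
  show ?thesis .
qed

lemmas has_derivative_f_y = has_derivative_deriv_y[where k = 0, simplified]
  has_derivative_deriv_y[where k = 1, simplified]
  has_derivative_deriv_y[where k = 2, unfolded numeral_2_eq_2, simplified]

lemma partial_potential:
  assumes "smooth_real f"
  shows "partial i (\<lambda>q. c * potential f q) p = c * potential_grad f p i"
proof -
  have "((\<lambda>q. c * potential f q) has_derivative (\<lambda>u. c * (u $ Cy * (p $ Cz1 + deriv f (p $ Cy) * p $ Cz2)
      + u $ Cz1 * p $ Cy + u $ Cz2 * f (p $ Cy)))) (at p)"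
    unfolding potential_def
    by (auto intro!: derivative_eq_intros has_derivative_coord has_derivative_f_y[OF assms] simp: algebra_simps)
  from partial_eq_derivative[OF this] show ?thesis
    by (cases i) (simp_all add: axis_def potential_grad_def)
qed

lemma has_derivative_potential_grad:
  assumes "smooth_real f"
  shows "((\<lambda>q. potential_grad f q j) has_derivative (\<lambda>u. \<Sum>i\<in>UNIV. u $ i * potential_hess f p i j)) (at p)"
proof (cases j)
  case Cy
  have "((\<lambda>q. q $ Cz1 + deriv f (q $ Cy) * q $ Cz2) has_derivative
     (\<lambda>u. u $ Cz1 + u $ Cz2 * deriv f (p $ Cy) + u $ Cy * (deriv (deriv f) (p $ Cy) * p $ Cz2))) (at p)"
    by (auto intro!: derivative_eq_intros has_derivative_coord has_derivative_f_y[OF assms] simp: algebra_simps)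
  then show ?thesis using Cy by (simp add: potential_grad_def potential_hess_def sum_coord algebra_simps)
next
  case Cz1
  have "((\<lambda>q::real^coord. q $ Cy) has_derivative (\<lambda>u. u $ Cy)) (at p)"
    by (rule has_derivative_coord)
  then show ?thesis using Cz1 by (simp add: potential_grad_def potential_hess_def sum_coord)
next
  case Cz2
  then show ?thesis using has_derivative_f_y(1)[OF assms]
    by (simp add: potential_grad_def potential_hess_def sum_coord mult.commute)
qed (simp_all add: potential_grad_def potential_hess_def sum_coord)

text \<open>The flat part of the metric pairs the coordinate \<open>i\<close> with \<open>dual i\<close>.\<close>

definition dual :: "coord \<Rightarrow> coord" where
  "dual i = (case i of Cx \<Rightarrow> Cxt | Cy \<Rightarrow> Cyt | Cz1 \<Rightarrow> Cz1 | Cz2 \<Rightarrow> Cz2 | Cyt \<Rightarrow> Cy | Cxt \<Rightarrow> Cx)"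

lemma dual_simps [simp]: "dual Cx = Cxt" "dual Cy = Cyt" "dual Cz1 = Cz1" "dual Cz2 = Cz2" "dual Cyt = Cy" "dual Cxt = Cx"
  by (simp_all add: dual_def)

lemma potential_grad_simps [simp]:
  "potential_grad f p Cx = 0" "potential_grad f p Cyt = 0" "potential_grad f p Cxt = 0"
  by (simp_all add: potential_grad_def)

lemma potential_hess_simps [simp]:
  "potential_hess f p i Cx = 0" "potential_hess f p i Cyt = 0" "potential_hess f p i Cxt = 0"
  "potential_hess f p Cx i = 0" "potential_hess f p Cyt i = 0" "potential_hess f p Cxt i = 0"
  by (auto simp: potential_hess_def)

lemma potential_hess_commute: "potential_hess f p i j = potential_hess f p j i"
  by (cases i; cases j) (simp_all add: potential_hess_def)

definition dx :: "coord \<Rightarrow> real" where "dx i = (if i = Cx then 1 else 0)"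
definition dxt :: "coord \<Rightarrow> real" where "dxt i = (if i = Cxt then 1 else 0)"

lemma dx_simps [simp]: "dx Cx = 1" "dx Cy = 0" "dx Cz1 = 0" "dx Cz2 = 0" "dx Cyt = 0" "dx Cxt = 0"
  "dxt Cx = 0" "dxt Cy = 0" "dxt Cz1 = 0" "dxt Cz2 = 0" "dxt Cyt = 0" "dxt Cxt = 1"
  by (simp_all add: dx_def dxt_def)

lemma g6_eq: "g6 f p $ i $ j = (if j = dual i then 1 else 0) - 2 * potential f p * dx i * dx j"
  by (cases i; cases j) (simp_all add: g6_def potential_def dual_def)

definition g6_inv :: "(real \<Rightarrow> real) \<Rightarrow> real^coord \<Rightarrow> real^coord^coord" where
  "g6_inv f p = (\<chi> i j. (if j = dual i then 1 else 0) + 2 * potential f p * dxt i * dxt j)"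

lemma g6_inv: "g6 f p ** g6_inv f p = mat 1" "g6_inv f p ** g6 f p = mat 1"
proof -
  have "(g6 f p ** g6_inv f p) $ i $ j = mat 1 $ i $ j" for i j
    by (cases i; cases j) (simp_all add: matrix_matrix_mult_def mat_def g6_eq g6_inv_def dual_def sum_coord)
  then show "g6 f p ** g6_inv f p = mat 1" by (simp add: vec_eq_iff)
  then show "g6_inv f p ** g6 f p = mat 1" by (simp add: matrix_left_right_inverse)
qed

lemma matrix_inv_g6: "matrix_inv (g6 f p) = g6_inv f p"
proof -
  have "g6 f p ** matrix_inv (g6 f p) = mat 1"
    unfolding matrix_inv_def by (rule someI2[of _ "g6_inv f p"]) (use g6_inv in auto)
  then show ?thesis
    by (metis g6_inv(2) matrix_mul_assoc matrix_mul_lid matrix_mul_rid)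
qed

lemma partial_g6:
  assumes "smooth_real f"
  shows "partial m (\<lambda>q. g6 f q $ i $ j) p = - 2 * dx i * dx j * potential_grad f p m"
proof (cases "i = Cx \<and> j = Cx")
  case True
  then show ?thesis
    using partial_potential[OF assms, of m "- 2" p] by (simp add: g6_eq dual_def)
next
  case False
  then have "(\<lambda>q. g6 f q $ i $ j) = (\<lambda>q. if j = dual i then 1 else 0)" by (auto simp: g6_eq dx_def)
  then show ?thesis using False by (auto simp: partial_def dx_def)
qed

text \<open>Only \<open>g\<^bsub>xx\<^esub>\<close> has nonzero derivatives, so each term carries two factors \<open>dx\<close>. If the index raised by the
  inverse metric is one of them, it becomes \<open>x-tilde\<close>; otherwise the raised index is that of the gradient
  of the potential.\<close>

lemma christoffel_g6:
  assumes "smooth_real f"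
  shows "christoffel (g6 f) p i j k = dx i * dx j * potential_grad f p (dual k)
     - dxt k * (dx j * potential_grad f p i + dx i * potential_grad f p j)"
  unfolding christoffel_def partial_g6[OF assms] matrix_inv_g6 g6_inv_def vec_lambda_beta sum_coord
  by (cases k) (simp_all add: dual_def potential_grad_def algebra_simps)

lemma has_derivative_christoffel_g6:
  assumes "smooth_real f"
  shows "((\<lambda>q. christoffel (g6 f) q j k l) has_derivative
     (\<lambda>u. \<Sum>i\<in>UNIV. u $ i * (dx j * dx k * potential_hess f p i (dual l)
       - dxt l * (dx k * potential_hess f p i j + dx j * potential_hess f p i k)))) (at p)"
  unfolding christoffel_g6[OF assms]
  by (auto intro!: derivative_eq_intros has_derivative_potential_grad[OF assms]
      simp: sum_distrib_left sum.distrib sum_subtractf algebra_simps)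

lemma partial_christoffel_g6:
  assumes "smooth_real f"
  shows "partial i (\<lambda>q. christoffel (g6 f) q j k l) p = dx j * dx k * potential_hess f p i (dual l)
       - dxt l * (dx k * potential_hess f p i j + dx j * potential_hess f p i k)"
  using partial_eq_derivative[OF has_derivative_christoffel_g6[OF assms]]
  by (simp add: axis_def if_distrib[of "\<lambda>x. x * _"] cong: if_cong)

text \<open>The quadratic terms contribute \<open>- dx\<^sub>i dx\<^sub>j dx\<^sub>k\<close> times a squared gradient, which is symmetric in \<open>i\<close>, \<open>j\<close>
  and cancels. What remains is linear in the second derivatives of the potential.\<close>

lemma curvature_op_g6:
  assumes "smooth_real f"
  shows "curvature_op (g6 f) p i j k l =
     dx k * (dx j * potential_hess f p i (dual l) - dx i * potential_hess f p j (dual l))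
     + dxt l * (dx i * potential_hess f p j k - dx j * potential_hess f p i k)"
proof -
  have quad: "christoffel (g6 f) p j k m * christoffel (g6 f) p i m l
      = - dx i * dx j * dx k * dxt l * potential_grad f p (dual m) * potential_grad f p m" for i j m
    unfolding christoffel_g6[OF assms] by (cases m) simp_all
  have "(\<Sum>m\<in>UNIV. christoffel (g6 f) p j k m * christoffel (g6 f) p i m l
                   - christoffel (g6 f) p i k m * christoffel (g6 f) p j m l) = 0"
    unfolding quad by (simp add: mult_ac)
  then show ?thesis
    unfolding curvature_op_def partial_christoffel_g6[OF assms]
    by (simp add: algebra_simps potential_hess_commute[of f p j i])
qed

lemma curvature_g6:
  assumes "smooth_real f"
  shows "curvature (g6 f) p i j k l =
     dx j * dx k * potential_hess f p i l - dx i * dx k * potential_hess f p j l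
     + dx i * dx l * potential_hess f p j k - dx j * dx l * potential_hess f p i k"
  unfolding curvature_def curvature_op_g6[OF assms] g6_eq sum_coord
  by (cases l) (simp_all add: algebra_simps)

definition hess_form :: "(real \<Rightarrow> real) \<Rightarrow> real^coord \<Rightarrow> real^coord \<Rightarrow> real^coord \<Rightarrow> real" where
  "hess_form f p a b = deriv (deriv f) (p $ Cy) * p $ Cz2 * a $ Cy * b $ Cy
     + a $ Cy * (b $ Cz1 + deriv f (p $ Cy) * b $ Cz2) + b $ Cy * (a $ Cz1 + deriv f (p $ Cy) * a $ Cz2)"

lemma hess_form_eq: "hess_form f p a b = (\<Sum>i\<in>UNIV. \<Sum>j\<in>UNIV. a $ i * (b $ j * potential_hess f p i j))"
  unfolding sum_coord by (simp add: hess_form_def potential_hess_def algebra_simps)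

text \<open>Up to sign, the Kulkarni-Nomizu product of \<open>dx\<^sup>2\<close> with the symmetric form \<open>h\<close>.\<close>

definition wedge_dx :: "(real^coord \<Rightarrow> real^coord \<Rightarrow> real) \<Rightarrow> real^coord \<Rightarrow> real^coord \<Rightarrow> real^coord \<Rightarrow> real^coord \<Rightarrow> real" where
  "wedge_dx h a b c d = b $ Cx * c $ Cx * h a d - a $ Cx * c $ Cx * h b d
     + a $ Cx * d $ Cx * h b c - b $ Cx * d $ Cx * h a c"

lemma tensor_eval_R_g6:
  assumes "smooth_real f"
  shows "tensor_eval (nabla_R (g6 f) 0) p [a, b, c, d] = wedge_dx (hess_form f p) a b c d"
proof -
  have "tensor_eval (nabla_R (g6 f) 0) p [a, b, c, d]
     = (\<Sum>i\<in>UNIV. \<Sum>j\<in>UNIV. \<Sum>k\<in>UNIV. \<Sum>l\<in>UNIV. a $ i * (b $ j * (c $ k * (d $ l * curvature (g6 f) p i j k l))))"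
    by (simp add: tensor_eval_Cons_Nil sum_distrib_left numeral_2_eq_2 numeral_3_eq_3)
  also have "\<dots> = wedge_dx (hess_form f p) a b c d"
  proof -
    have dx: "(\<Sum>k\<in>UNIV. dx k * F k) = F Cx" for F by (simp add: sum_coord)
    let ?S = "\<lambda>F. \<Sum>i\<in>UNIV. \<Sum>j\<in>UNIV. \<Sum>k\<in>UNIV. \<Sum>l\<in>UNIV. a $ i * (b $ j * (c $ k * (d $ l * F i j k l)))"
    let ?h = "potential_hess f p"
    have "?S (\<lambda>i j k l. dx j * dx k * ?h i l)
        = (\<Sum>i\<in>UNIV. \<Sum>j\<in>UNIV. dx j * (\<Sum>k\<in>UNIV. dx k * (\<Sum>l\<in>UNIV. b $ j * c $ k * (a $ i * (d $ l * ?h i l)))))"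
      by (simp add: sum_distrib_left mult_ac)
    then have 1: "?S (\<lambda>i j k l. dx j * dx k * ?h i l) = b $ Cx * c $ Cx * hess_form f p a d"
      unfolding dx by (simp only: hess_form_eq sum_distrib_left)
    have "?S (\<lambda>i j k l. dx i * dx k * ?h j l)
        = (\<Sum>i\<in>UNIV. dx i * (\<Sum>j\<in>UNIV. \<Sum>k\<in>UNIV. dx k * (\<Sum>l\<in>UNIV. a $ i * c $ k * (b $ j * (d $ l * ?h j l)))))"
      by (simp add: sum_distrib_left mult_ac)
    then have 2: "?S (\<lambda>i j k l. dx i * dx k * ?h j l) = a $ Cx * c $ Cx * hess_form f p b d"
      unfolding dx by (simp only: hess_form_eq sum_distrib_left)
    have "?S (\<lambda>i j k l. dx i * dx l * ?h j k)
        = (\<Sum>i\<in>UNIV. dx i * (\<Sum>j\<in>UNIV. \<Sum>k\<in>UNIV. \<Sum>l\<in>UNIV. dx l * (a $ i * d $ l * (b $ j * (c $ k * ?h j k)))))"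
      by (simp add: sum_distrib_left mult_ac)
    then have 3: "?S (\<lambda>i j k l. dx i * dx l * ?h j k) = a $ Cx * d $ Cx * hess_form f p b c"
      unfolding dx by (simp only: hess_form_eq sum_distrib_left)
    have "?S (\<lambda>i j k l. dx j * dx l * ?h i k)
        = (\<Sum>i\<in>UNIV. \<Sum>j\<in>UNIV. dx j * (\<Sum>k\<in>UNIV. \<Sum>l\<in>UNIV. dx l * (b $ j * d $ l * (a $ i * (c $ k * ?h i k)))))"
      by (simp add: sum_distrib_left mult_ac)
    then have 4: "?S (\<lambda>i j k l. dx j * dx l * ?h i k) = b $ Cx * d $ Cx * hess_form f p a c"
      unfolding dx by (simp only: hess_form_eq sum_distrib_left)
    show ?thesis
      unfolding curvature_g6[OF assms] wedge_dx_def 1[symmetric] 2[symmetric] 3[symmetric] 4[symmetric]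
      by (simp only: distrib_left right_diff_distrib sum.distrib sum_subtractf)
  qed
  finally show ?thesis .
qed

text \<open>The third derivative of the potential, with its first argument as direction of differentiation.\<close>

definition cubic_form :: "(real \<Rightarrow> real) \<Rightarrow> real^coord \<Rightarrow> real^coord \<Rightarrow> real^coord \<Rightarrow> real^coord \<Rightarrow> real" where
  "cubic_form f p w a b = deriv (deriv (deriv f)) (p $ Cy) * p $ Cz2 * w $ Cy * a $ Cy * b $ Cy
     + deriv (deriv f) (p $ Cy) * (w $ Cy * a $ Cy * b $ Cz2 + w $ Cy * a $ Cz2 * b $ Cy + w $ Cz2 * a $ Cy * b $ Cy)"

lemma has_derivative_hess_form:
  assumes "smooth_real f"
  shows "((\<lambda>q. hess_form f q a b) has_derivative (\<lambda>w. cubic_form f p w a b)) (at p)"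
  unfolding hess_form_def cubic_form_def
  by (auto intro!: derivative_eq_intros has_derivative_coord has_derivative_f_y[OF assms] simp: algebra_simps)

lemma christoffel_form_g6:
  assumes "smooth_real f"
  shows "christoffel_form (g6 f) p w v $ Cx = 0" "christoffel_form (g6 f) p w v $ Cy = 0"
    "christoffel_form (g6 f) p w v $ Cz1 = w $ Cx * v $ Cx * p $ Cy"
    "christoffel_form (g6 f) p w v $ Cz2 = w $ Cx * v $ Cx * f (p $ Cy)"
  by (simp_all add: christoffel_form_def christoffel_g6[OF assms] dual_def potential_grad_def sum_coord)

lemma curvature_g6_differentiable:
  assumes "smooth_real f"
  shows "(\<lambda>q. nabla_R (g6 f) 0 q is) differentiable at p"
proof -
  have "(\<lambda>q::real^coord. deriv f (q $ Cy)) differentiable at p"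
    "(\<lambda>q::real^coord. deriv (deriv f) (q $ Cy) * q $ Cz2) differentiable at p"
    by (rule differentiableI[OF has_derivative_f_y(2)[OF assms]],
        rule differentiableI[OF has_derivative_mult[OF has_derivative_f_y(3)[OF assms] has_derivative_coord]])
  then have "(\<lambda>q. potential_hess f q i j) differentiable at p" for i j
    by (cases i; cases j) (simp_all add: potential_hess_def)
  then show ?thesis
    by (simp add: curvature_g6[OF assms])
qed

text \<open>The connection terms cancel in pairs: \<open>\<nabla>\<^bsub>w\<^esub> v\<close> has no \<open>x\<close> component, and its part seen by the Hessian is
  \<open>w\<^sub>x v\<^sub>x\<close> times one fixed vector, so antisymmetry of the product with \<open>dx\<^sup>2\<close> applies.\<close>

lemma tensor_eval_nabla_R_g6:
  assumes "smooth_real f"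
  shows "tensor_eval (nabla_R (g6 f) 1) p [a, b, c, d, w] = wedge_dx (cubic_form f p w) a b c d"
proof -
  have "((\<lambda>q. tensor_eval (nabla_R (g6 f) 0) q [a, b, c, d]) has_derivative (\<lambda>w. wedge_dx (cubic_form f p w) a b c d)) (at p)"
    unfolding tensor_eval_R_g6[OF assms] wedge_dx_def
    by (rule derivative_eq_intros has_derivative_hess_form[OF assms] refl | simp)+
  from has_derivative_unique[OF this has_derivative_tensor_eval_const[OF curvature_g6_differentiable[OF assms]]]
  have 1: "tensor_eval (directional_tensor (nabla_R (g6 f) 0) w) p [a, b, c, d] = wedge_dx (cubic_form f p w) a b c d"
    by metis
  have "tensor_eval (nabla_R (g6 f) 1) p ([a, b, c, d] @ [w]) = tensor_eval (directional_tensor (nabla_R (g6 f) 0) w) p [a, b, c, d]"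
    unfolding One_nat_def nabla_R.simps(2) tensor_eval_cov_deriv
    by (simp add: lessThan_Suc numeral_eq_Suc tensor_eval_R_g6[OF assms] wedge_dx_def hess_form_def christoffel_form_g6[OF assms] algebra_simps del: nabla_R.simps)
  with 1 show ?thesis by simp
qed

section \<open>Smoothness and the plane wave condition\<close>

text \<open>A class of functions closed under partial differentiation that contains the metric coefficients. Membership
  therefore gives smoothness, without computing higher derivatives.\<close>

inductive elementary :: "(real \<Rightarrow> real) \<Rightarrow> (real^coord \<Rightarrow> real) \<Rightarrow> bool" for f where
  const: "elementary f (\<lambda>p. c)"
| coord: "elementary f (\<lambda>p. p $ i)"
| deriv: "elementary f (\<lambda>p. (deriv ^^ k) f (p $ Cy))"
| add: "elementary f F \<Longrightarrow> elementary f G \<Longrightarrow> elementary f (\<lambda>p. F p + G p)"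
| mult: "elementary f F \<Longrightarrow> elementary f G \<Longrightarrow> elementary f (\<lambda>p. F p * G p)"

lemma elementary_diff:
  assumes "elementary f F" "elementary f G"
  shows "elementary f (\<lambda>p. F p - G p)"
proof -
  have "elementary f (\<lambda>p. F p + (- 1) * G p)" by (intro elementary.intros assms)
  then show ?thesis by simp
qed

lemma elementary_sum:
  assumes "\<And>i. i \<in> A \<Longrightarrow> elementary f (F i)"
  shows "elementary f (\<lambda>p. \<Sum>i\<in>A. F i p)"
  using assms by (induction A rule: infinite_finite_induct) (auto intro: elementary.intros)

lemma elementary_partial:
  assumes "smooth_real f" "elementary f F"
  shows "F differentiable at p \<and> elementary f (partial i F)"
  using assms(2)
proof (induction arbitrary: p)
  case (const c)
  have "partial i (\<lambda>p. c) = (\<lambda>p. 0)" by (simp add: fun_eq_iff partial_def)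
  then show ?case by (simp add: elementary.const)
next
  case (coord j)
  have "partial i (\<lambda>p. p $ j) = (\<lambda>p. axis i 1 $ j)"
    using partial_eq_derivative[OF has_derivative_coord] by blast
  then show ?case using differentiableI[OF has_derivative_coord] by (simp add: elementary.const)
next
  case (deriv k)
  have "partial i (\<lambda>p. (deriv ^^ k) f (p $ Cy)) = (\<lambda>p. (deriv ^^ Suc k) f (p $ Cy) * axis i 1 $ Cy)"
    using partial_eq_derivative[OF has_derivative_deriv_y[OF assms(1)]] by blast
  moreover have "elementary f (\<lambda>p. (deriv ^^ Suc k) f (p $ Cy) * axis i 1 $ Cy)"
    by (intro elementary.intros)
  ultimately show ?case using differentiableI[OF has_derivative_deriv_y[OF assms(1)]] by simp
next
  case (add F G)
  have "partial i (\<lambda>p. F p + G p) = (\<lambda>p. partial i F p + partial i G p)"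
    using partial_eq_derivative[OF has_derivative_add[OF has_derivative_dir_deriv has_derivative_dir_deriv]] add
    by fastforce
  then show ?case using add by (simp add: elementary.add)
next
  case (mult F G)
  have "partial i (\<lambda>p. F p * G p) = (\<lambda>p. F p * partial i G p + partial i F p * G p)"
    using partial_eq_derivative[OF has_derivative_mult[OF has_derivative_dir_deriv has_derivative_dir_deriv]] mult
    by fastforce
  then show ?case using mult by (simp add: elementary.add elementary.mult)
qed

lemma smooth_on_elementary:
  assumes "smooth_real f" "elementary f F"
  shows "smooth_on U F"
proof -
  have "elementary f (foldr partial is F)" for "is"
    by (induction "is") (use assms elementary_partial in auto)
  then show ?thesis unfolding smooth_on_def using elementary_partial[OF assms(1)] by blast
qed

lemma elementary_f: "elementary f (\<lambda>p. f (p $ Cy))" "elementary f (\<lambda>p. deriv f (p $ Cy))"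
  using elementary.deriv[of f 0] elementary.deriv[of f 1] by simp_all

lemma elementary_g6: "elementary f (\<lambda>p. g6 f p $ i $ j)"
  unfolding g6_eq potential_def by (intro elementary_diff elementary.intros elementary_f)

lemma elementary_christoffel_g6:
  assumes "smooth_real f"
  shows "elementary f (\<lambda>p. christoffel (g6 f) p i j k)"
proof -
  have "elementary f (\<lambda>p. potential_grad f p i)" for i
    by (cases i) (auto simp: potential_grad_def intro!: elementary.intros elementary_f)
  then show ?thesis
    unfolding christoffel_g6[OF assms] by (intro elementary_diff elementary.intros)
qed

lemma elementary_nabla_R_g6:
  assumes "smooth_real f"
  shows "elementary f (\<lambda>p. nabla_R (g6 f) k p is)"
proof (induction k arbitrary: "is")
  case 0
  have part: "elementary f (\<lambda>p. partial i (\<lambda>q. christoffel (g6 f) q j k l) p)" for i j k l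
    using elementary_partial[OF assms elementary_christoffel_g6[OF assms]] by blast
  show ?case
    unfolding nabla_R.simps curvature_def curvature_op_def
    by (intro elementary_sum elementary_diff elementary.intros part elementary_g6 elementary_christoffel_g6[OF assms])
next
  case (Suc k)
  have part: "elementary f (\<lambda>p. partial i (\<lambda>q. nabla_R (g6 f) k q js) p)" for i js
    using elementary_partial[OF assms Suc] by blast
  show ?case
    unfolding nabla_R.simps cov_deriv_def Let_def
    by (intro elementary_sum elementary_diff elementary.intros part Suc elementary_christoffel_g6[OF assms])
qed

lemma pseudo_riemannian_g6:
  assumes "smooth_real f"
  shows "pseudo_riemannian (g6 f)"
proof -
  have "g6 f p $ i $ j = g6 f p $ j $ i" for p i j
    by (cases i; cases j) (simp_all add: g6_eq)
  moreover have "invertible (g6 f p)" for p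
    unfolding invertible_def using g6_inv by blast
  ultimately show ?thesis
    unfolding pseudo_riemannian_def
    by (auto simp: transpose_def vec_eq_iff intro: smooth_on_elementary[OF assms elementary_g6])
qed

lemma smooth_geometry_g6:
  assumes "smooth_real f"
  shows "smooth_geometry (g6 f)"
  unfolding smooth_geometry_def
  using pseudo_riemannian_g6[OF assms] elementary_partial[OF assms elementary_christoffel_g6[OF assms]]
    elementary_partial[OF assms elementary_nabla_R_g6[OF assms]] by blast

lemma generalized_plane_wave_g6:
  assumes "smooth_real f"
  shows "generalized_plane_wave (g6 f)"
proof -
  have zero: "christoffel (g6 f) p i j k = 0" if "\<not> max i j < k" for p i j k
    using that unfolding christoffel_g6[OF assms]
    by (cases k; cases i; cases j) (simp_all add: max_def less_eq_coord_def less_coord_def)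
  have dep: "christoffel (g6 f) p i j k = christoffel (g6 f) q i j k" if l: "\<And>l. l < k \<Longrightarrow> p $ l = q $ l" for p q i j k
  proof -
    have "potential_grad f p (dual k) = potential_grad f q (dual k)"
      using l[of Cy] l[of Cz1] l[of Cz2] by (cases k) (simp_all add: potential_grad_def less_coord_def)
    moreover have "potential_grad f p i = potential_grad f q i" if "k = Cxt" for i
      using l[of Cy] l[of Cz1] l[of Cz2] that by (cases i) (simp_all add: potential_grad_def less_coord_def)
    ultimately show ?thesis
      unfolding christoffel_g6[OF assms] by (cases "k = Cxt") (simp_all add: dxt_def)
  qed
  show ?thesis
    unfolding generalized_plane_wave_def using pseudo_riemannian_g6[OF assms] zero dep by blast
qed

section \<open>Curvature homogeneity\<close>

lemma metric_form_g6:
  "metric_form (g6 f) p v w = v $ Cx * w $ Cxt + v $ Cxt * w $ Cx + v $ Cy * w $ Cyt + v $ Cyt * w $ Cy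
     + v $ Cz1 * w $ Cz1 + v $ Cz2 * w $ Cz2 - 2 * potential f p * v $ Cx * w $ Cx"
  unfolding metric_form_def inner_vec_def matrix_vector_mult_def vec_lambda_beta g6_eq sum_coord
  by (simp add: algebra_simps)

text \<open>With \<open>s = sqrt (1 + f'\<^sup>2)\<close>, the unit covector \<open>\<zeta> = (dz\<^sub>1 + f' dz\<^sub>2) / s\<close> turns the Hessian into
  \<open>2 (s dy) \<zeta> + f'' z\<^sub>2 dy\<^sup>2\<close>. Replacing \<open>\<zeta>\<close> by \<open>\<zeta> + k s dy\<close> absorbs the second term exactly when
  \<open>2 k s\<^sup>2 = f'' z\<^sub>2\<close>; the component at \<open>y-tilde\<close> is then forced by the metric.\<close>

definition normal_coframe :: "(real \<Rightarrow> real) \<Rightarrow> real^coord \<Rightarrow> real^coord \<Rightarrow> real^coord" where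
  "normal_coframe f p v =
    (let s = sqrt (1 + (deriv f (p $ Cy))\<^sup>2);
         \<zeta> = (v $ Cz1 + deriv f (p $ Cy) * v $ Cz2) / s;
         k = deriv (deriv f) (p $ Cy) * p $ Cz2 / (2 * s\<^sup>2)
     in \<chi> i. case i of
          Cx \<Rightarrow> v $ Cx
        | Cy \<Rightarrow> s * v $ Cy
        | Cz1 \<Rightarrow> \<zeta> + k * (s * v $ Cy)
        | Cz2 \<Rightarrow> (v $ Cz2 - deriv f (p $ Cy) * v $ Cz1) / s
        | Cyt \<Rightarrow> v $ Cyt / s - k * \<zeta> - k\<^sup>2 / 2 * (s * v $ Cy)
        | Cxt \<Rightarrow> v $ Cxt - potential f p * v $ Cx)"

definition model_metric :: "real^coord \<Rightarrow> real^coord \<Rightarrow> real" where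
  "model_metric v w = (\<Sum>i\<in>UNIV. v $ i * w $ dual i)"

definition model_hess :: "real^coord \<Rightarrow> real^coord \<Rightarrow> real" where
  "model_hess a b = a $ Cy * b $ Cz1 + a $ Cz1 * b $ Cy"

lemma normal_coframe_metric:
  "model_metric (normal_coframe f p v) (normal_coframe f p w) = metric_form (g6 f) p v w"
proof -
  define m where "m = deriv f (p $ Cy)"
  define s where "s = sqrt (1 + m\<^sup>2)"
  define k where "k = deriv (deriv f) (p $ Cy) * p $ Cz2 / (2 * s\<^sup>2)"
  have s: "s > 0" "s\<^sup>2 = 1 + m\<^sup>2" unfolding s_def by (simp_all add: add_pos_nonneg)
  \<comment> \<open>The covectors \<open>(dz\<^sub>1 + m dz\<^sub>2) / s\<close> and \<open>(dz\<^sub>2 - m dz\<^sub>1) / s\<close> are orthonormal.\<close>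
  have rot: "(a1 + m * a2) / s * ((b1 + m * b2) / s) + (a2 - m * a1) / s * ((b2 - m * b1) / s) = a1 * b1 + a2 * b2"
    for a1 a2 b1 b2 :: real
  proof -
    have "(a1 + m * a2) / s * ((b1 + m * b2) / s) + (a2 - m * a1) / s * ((b2 - m * b1) / s)
      = (a1 * b1 + a2 * b2) * (1 + m\<^sup>2) / s\<^sup>2"
      using s(1) by (simp add: field_simps power2_eq_square)
    moreover have "1 + m\<^sup>2 \<noteq> 0" using s by auto
    ultimately show ?thesis using s(2) by simp
  qed
  show ?thesis
    using rot[of "v $ Cz1" "v $ Cz2" "w $ Cz1" "w $ Cz2"] s(1)
    unfolding model_metric_def normal_coframe_def metric_form_g6 Let_def vec_lambda_beta sum_coord
      m_def[symmetric] s_def[symmetric] k_def[symmetric]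
    by (simp add: algebra_simps power2_eq_square)
qed

lemma normal_coframe_hess:
  "model_hess (normal_coframe f p a) (normal_coframe f p b) = hess_form f p a b"
proof -
  define m where "m = deriv f (p $ Cy)"
  define s where "s = sqrt (1 + m\<^sup>2)"
  define c where "c = deriv (deriv f) (p $ Cy) * p $ Cz2"
  have s: "s > 0" unfolding s_def by (simp add: add_pos_nonneg)
  show ?thesis
    unfolding model_hess_def normal_coframe_def hess_form_def Let_def vec_lambda_beta
      m_def[symmetric] s_def[symmetric] c_def[symmetric]
    using s by (simp add: field_simps power2_eq_square)
qed

lemma linear_normal_coframe: "linear (normal_coframe f p)"
proof (rule linearI)
  show "normal_coframe f p (v + w) = normal_coframe f p v + normal_coframe f p w" for v w
    unfolding vec_eq_iff
  proof
    show "normal_coframe f p (v + w) $ i = (normal_coframe f p v + normal_coframe f p w) $ i" for i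
      by (cases i) (simp_all add: normal_coframe_def Let_def algebra_simps add_divide_distrib diff_divide_distrib)
  qed
  show "normal_coframe f p (c *\<^sub>R v) = c *\<^sub>R normal_coframe f p v" for c v
    unfolding vec_eq_iff
  proof
    show "normal_coframe f p (c *\<^sub>R v) $ i = (c *\<^sub>R normal_coframe f p v) $ i" for i
      by (cases i) (simp_all add: normal_coframe_def Let_def algebra_simps add_divide_distrib diff_divide_distrib)
  qed
qed

lemma bij_normal_coframe:
  assumes "smooth_real f"
  shows "bij (normal_coframe f p)"
proof -
  have "inj (normal_coframe f p)"
    unfolding linear_injective_0[OF linear_normal_coframe]
  proof (intro allI impI)
    fix v assume "normal_coframe f p v = 0"
    then have "metric_form (g6 f) p v w = 0" for w
      using normal_coframe_metric[of f p v w] by (simp add: model_metric_def)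
    then show "v = 0" by (rule metric_form_nondegenerate[OF pseudo_riemannian_g6[OF assms]])
  qed
  then show ?thesis
    using linear_injective_imp_surjective[OF linear_normal_coframe] by (simp add: bij_def)
qed

lemma wedge_dx_normal_coframe:
  "wedge_dx model_hess (normal_coframe f p a) (normal_coframe f p b) (normal_coframe f p c) (normal_coframe f p d)
    = wedge_dx (hess_form f p) a b c d"
proof -
  have "normal_coframe f p v $ Cx = v $ Cx" for v by (simp add: normal_coframe_def Let_def)
  then show ?thesis by (simp add: wedge_dx_def normal_coframe_hess)
qed

text \<open>Both models are isomorphic to one and the same algebraic model, by means of their normal coframes.\<close>

lemma models_isomorphic_0_g6:
  assumes "smooth_real f\<^sub>1" "smooth_real f\<^sub>2"
  shows "models_isomorphic 0 (g6 f\<^sub>1) P (g6 f\<^sub>2) Q"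
proof -
  let ?A = "normal_coframe f\<^sub>1 P" and ?B = "normal_coframe f\<^sub>2 Q"
  let ?\<Psi> = "inv ?B \<circ> ?A"
  note B = bij_normal_coframe[OF assms(2), of Q]
  have \<Psi>: "?B (?\<Psi> v) = ?A v" for v
    using B by (simp add: bij_is_surj surj_f_inv_f)
  have "linear ?\<Psi>"
    using linear_compose[OF linear_normal_coframe inj_linear_imp_inv_linear[OF linear_normal_coframe bij_is_inj[OF B]]]
    by blast
  moreover have "bij ?\<Psi>"
    using bij_normal_coframe[OF assms(1)] B by (simp add: bij_comp bij_imp_bij_inv)
  moreover have "metric_form (g6 f\<^sub>2) Q (?\<Psi> v) (?\<Psi> w) = metric_form (g6 f\<^sub>1) P v w" for v w
    by (simp only: normal_coframe_metric[symmetric] \<Psi>)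
  moreover have "tensor_eval (nabla_R (g6 f\<^sub>2) 0) Q (map ?\<Psi> vs) = tensor_eval (nabla_R (g6 f\<^sub>1) 0) P vs"
    if len: "length vs = 4" for vs
  proof -
    obtain a b c d where vs: "vs = [a, b, c, d]"
      using len by (auto simp: length_Suc_conv numeral_eq_Suc)
    show ?thesis
      unfolding vs list.map tensor_eval_R_g6[OF assms(1)] tensor_eval_R_g6[OF assms(2)]
        wedge_dx_normal_coframe[symmetric] \<Psi> ..
  qed
  ultimately show ?thesis
    unfolding models_isomorphic_def model_isomorphism_def by (intro exI[of _ ?\<Psi>]) auto
qed

section \<open>The angle invariant\<close>

text \<open>Evaluation at the basis vectors shows that the metric dual of \<open>R(u,v,w,\<cdot>)\<close> has its components along
  \<open>z\<^sub>1, z\<^sub>2\<close> proportional to \<open>(1, f')\<close>, and that of \<open>\<nabla>R(u',v',w',\<cdot>;m)\<close> has them proportional to \<open>(0, 1)\<close>.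
  Neither has a component along \<open>x\<close> or \<open>y\<close>, so these alone determine the inner products. The
  conclusion is \<open>cos\<^sup>2 = f'\<^sup>2 / (1 + f'\<^sup>2)\<close> with denominators cleared, hence valid for null vectors too.\<close>

lemma angle_between_R_and_nabla_R:
  assumes "smooth_real f"
    and A: "\<And>z. metric_form (g6 f) p A z = tensor_eval (nabla_R (g6 f) 0) p [u, v, w, z]"
    and B: "\<And>z. metric_form (g6 f) p B z = tensor_eval (nabla_R (g6 f) 1) p [u', v', w', z, m]"
  shows "(metric_form (g6 f) p A B)\<^sup>2 * (1 + (deriv f (p $ Cy))\<^sup>2)
     = (deriv f (p $ Cy))\<^sup>2 * metric_form (g6 f) p A A * metric_form (g6 f) p B B"
proof -
  note A' = A[unfolded metric_form_g6 tensor_eval_R_g6[OF assms(1)] wedge_dx_def hess_form_def]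
  note B' = B[unfolded metric_form_g6 tensor_eval_nabla_R_g6[OF assms(1)] wedge_dx_def cubic_form_def]
  define \<kappa> where "\<kappa> = u $ Cy * (v $ Cx * w $ Cx) - u $ Cx * (v $ Cy * w $ Cx)"
  have "A $ Cx = 0" "A $ Cy = 0" "A $ Cz1 = \<kappa>" "A $ Cz2 = deriv f (p $ Cy) * \<kappa>"
    using A'[of "axis Cxt 1"] A'[of "axis Cyt 1"] A'[of "axis Cz1 1"] A'[of "axis Cz2 1"]
    by (simp_all add: axis_def \<kappa>_def algebra_simps)
  moreover have "B $ Cx = 0" "B $ Cy = 0" "B $ Cz1 = 0"
    using B'[of "axis Cxt 1"] B'[of "axis Cyt 1"] B'[of "axis Cz1 1"]
    by (simp_all add: axis_def)
  ultimately show ?thesis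
    by (simp add: metric_form_g6 algebra_simps power2_eq_square)
qed

lemma alpha6_power2: "(alpha6 f p)\<^sup>2 = (deriv f (p $ Cy))\<^sup>2 / (1 + (deriv f (p $ Cy))\<^sup>2)"
  by (simp add: alpha6_def power_divide add_nonneg_nonneg)

text \<open>Take explicit dual vectors \<open>A\<close>, \<open>B\<close> of nonzero length at the first point. A model isomorphism carries them
  to dual vectors of the same kind at the second point with the same inner products, and these determine
  \<open>f'\<^sup>2\<close> at either point.\<close>

lemma alpha6_model_invariant:
  assumes f1: "admissible f\<^sub>1" and f2: "admissible f\<^sub>2"
    and iso: "models_isomorphic 1 (g6 f\<^sub>1) P\<^sub>1 (g6 f\<^sub>2) P\<^sub>2"
  shows "alpha6 f\<^sub>1 P\<^sub>1 = alpha6 f\<^sub>2 P\<^sub>2"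
proof -
  let ?m = "metric_form (g6 f\<^sub>1) P\<^sub>1"
  have s1: "smooth_real f\<^sub>1" and s2: "smooth_real f\<^sub>2" and pos: "deriv (deriv f\<^sub>1) (P\<^sub>1 $ Cy) > 0"
    using f1 f2 by (simp_all add: admissible_def)
  obtain \<Psi> where \<Psi>: "bij \<Psi>"
    and met: "\<And>v w. metric_form (g6 f\<^sub>2) P\<^sub>2 (\<Psi> v) (\<Psi> w) = ?m v w"
    and ten: "\<And>i vs. i \<le> 1 \<Longrightarrow> length vs = 4 + i \<Longrightarrow>
      tensor_eval (nabla_R (g6 f\<^sub>2) i) P\<^sub>2 (map \<Psi> vs) = tensor_eval (nabla_R (g6 f\<^sub>1) i) P\<^sub>1 vs"
    using iso unfolding models_isomorphic_def model_isomorphism_def by blast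
  let ?x = "axis Cx 1 :: real^coord" and ?y = "axis Cy 1 :: real^coord"
  define c where "c = deriv (deriv f\<^sub>1) (P\<^sub>1 $ Cy)"
  \<comment> \<open>The metric duals of \<open>R(\<partial>\<^sub>y, \<partial>\<^sub>x, \<partial>\<^sub>x, \<cdot>)\<close> and \<open>\<nabla>R(\<partial>\<^sub>y, \<partial>\<^sub>x, \<partial>\<^sub>x, \<cdot>; \<partial>\<^sub>y)\<close>.\<close>
  define A :: "real^coord" where "A = (\<chi> i. case i of Cz1 \<Rightarrow> 1 | Cz2 \<Rightarrow> deriv f\<^sub>1 (P\<^sub>1 $ Cy) | Cyt \<Rightarrow> c * P\<^sub>1 $ Cz2 | _ \<Rightarrow> 0)"
  define B :: "real^coord" where "B = (\<chi> i. case i of Cz2 \<Rightarrow> c | Cyt \<Rightarrow> deriv (deriv (deriv f\<^sub>1)) (P\<^sub>1 $ Cy) * P\<^sub>1 $ Cz2 | _ \<Rightarrow> 0)"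
  have A: "?m A z = tensor_eval (nabla_R (g6 f\<^sub>1) 0) P\<^sub>1 [?y, ?x, ?x, z]" for z
    unfolding metric_form_g6 tensor_eval_R_g6[OF s1] wedge_dx_def hess_form_def
    by (simp add: axis_def A_def c_def algebra_simps)
  have B: "?m B z = tensor_eval (nabla_R (g6 f\<^sub>1) 1) P\<^sub>1 [?y, ?x, ?x, z, ?y]" for z
    unfolding metric_form_g6 tensor_eval_nabla_R_g6[OF s1] wedge_dx_def cubic_form_def
    by (simp add: axis_def B_def c_def algebra_simps)
  have "metric_form (g6 f\<^sub>2) P\<^sub>2 (\<Psi> A) z = tensor_eval (nabla_R (g6 f\<^sub>2) 0) P\<^sub>2 [\<Psi> ?y, \<Psi> ?x, \<Psi> ?x, z]"
    and "metric_form (g6 f\<^sub>2) P\<^sub>2 (\<Psi> B) z = tensor_eval (nabla_R (g6 f\<^sub>2) 1) P\<^sub>2 [\<Psi> ?y, \<Psi> ?x, \<Psi> ?x, z, \<Psi> ?y]" for z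
  proof -
    obtain z' where z: "z = \<Psi> z'" using \<Psi> by (meson bij_pointE)
    show "metric_form (g6 f\<^sub>2) P\<^sub>2 (\<Psi> A) z = tensor_eval (nabla_R (g6 f\<^sub>2) 0) P\<^sub>2 [\<Psi> ?y, \<Psi> ?x, \<Psi> ?x, z]"
      using ten[of 0 "[?y, ?x, ?x, z']"] unfolding z met A by simp
    show "metric_form (g6 f\<^sub>2) P\<^sub>2 (\<Psi> B) z = tensor_eval (nabla_R (g6 f\<^sub>2) 1) P\<^sub>2 [\<Psi> ?y, \<Psi> ?x, \<Psi> ?x, z, \<Psi> ?y]"
      using ten[of 1 "[?y, ?x, ?x, z', ?y]"] unfolding z met B by simp
  qed
  from angle_between_R_and_nabla_R[OF s2 this]
  have "(?m A B)\<^sup>2 * (1 + (deriv f\<^sub>2 (P\<^sub>2 $ Cy))\<^sup>2) = (deriv f\<^sub>2 (P\<^sub>2 $ Cy))\<^sup>2 * ?m A A * ?m B B"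
    by (simp only: met)
  moreover have "?m A A = 1 + (deriv f\<^sub>1 (P\<^sub>1 $ Cy))\<^sup>2" "?m A B = c * deriv f\<^sub>1 (P\<^sub>1 $ Cy)" "?m B B = c\<^sup>2"
    by (simp_all add: metric_form_g6 A_def B_def power2_eq_square)
  ultimately have "c\<^sup>2 * (deriv f\<^sub>1 (P\<^sub>1 $ Cy))\<^sup>2 = c\<^sup>2 * (deriv f\<^sub>2 (P\<^sub>2 $ Cy))\<^sup>2"
    by (simp add: power_mult_distrib algebra_simps)
  moreover have "c\<^sup>2 \<noteq> 0" using pos by (simp add: c_def)
  ultimately have "(deriv f\<^sub>1 (P\<^sub>1 $ Cy))\<^sup>2 = (deriv f\<^sub>2 (P\<^sub>2 $ Cy))\<^sup>2" by simp
  then show ?thesis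
    unfolding alpha6_def by (metis real_sqrt_abs)
qed

text \<open>A constant value forces \<open>\<bar>f'\<bar>\<close> to be constant, while the strictly increasing \<open>f'\<close> takes three different
  values at \<open>0\<close>, \<open>1\<close>, \<open>2\<close>.\<close>

lemma alpha6_not_constant:
  assumes f: "admissible f"
  shows "\<exists>P Q. alpha6 f P \<noteq> alpha6 f Q"
proof (rule ccontr)
  assume "\<not> ?thesis"
  then have "alpha6 f (vec s) = alpha6 f (vec t)" for s t by blast
  then have "(alpha6 f (vec s))\<^sup>2 = (alpha6 f (vec t))\<^sup>2" for s t by metis
  moreover have "1 + (deriv f t)\<^sup>2 \<noteq> 0" for t by (smt (verit) zero_le_power2)
  ultimately have "(deriv f s)\<^sup>2 = (deriv f t)\<^sup>2" for s t
    by (simp add: alpha6_power2 frac_eq_eq algebra_simps)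
  then have eq: "\<bar>deriv f s\<bar> = \<bar>deriv f t\<bar>" for s t by (metis real_sqrt_abs)
  have "DERIV (deriv f) x :> deriv (deriv f) x \<and> deriv (deriv f) x > 0" for x
    using f smooth_real_DERIV[of f 1 x] by (simp add: admissible_def)
  then have "deriv f s < deriv f t" if "s < t" for s t
    using DERIV_pos_imp_increasing[OF that] by blast
  from this[of 0 1] this[of 1 2] show False using eq[of 0 1] eq[of 1 2] by linarith
qed

section \<open>Weyl invariants\<close>

text \<open>The weight under the boost that scales \<open>x\<close> and \<open>x-tilde\<close> inversely to each other.\<close>

definition weight :: "coord \<Rightarrow> int" where
  "weight i = (case i of Cx \<Rightarrow> 1 | Cxt \<Rightarrow> - 1 | _ \<Rightarrow> 0)"

lemma weight_christoffel:
  assumes "smooth_real f" "christoffel (g6 f) p i j l \<noteq> 0"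
  shows "weight l \<le> weight i + weight j" "i \<noteq> Cxt"
  using assms(2) unfolding christoffel_g6[OF assms(1)]
  by (cases i; cases j; cases l; simp add: weight_def)+

lemma weight_curvature:
  assumes "smooth_real f" "curvature (g6 f) p i j k l \<noteq> 0"
  shows "weight i + weight j + weight k + weight l = 2"
proof -
  have "weight a = 0 \<and> weight b = 0" if "potential_hess f p a b \<noteq> 0" for a b
    using that by (cases a; cases b) (simp_all add: weight_def)
  moreover have "weight a = 1" if "dx a \<noteq> 0" for a
    using that by (cases a) (simp_all add: weight_def)
  moreover have "dx j * dx k * potential_hess f p i l \<noteq> 0 \<or> dx i * dx k * potential_hess f p j l \<noteq> 0
     \<or> dx i * dx l * potential_hess f p j k \<noteq> 0 \<or> dx j * dx l * potential_hess f p i k \<noteq> 0"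
    using assms(2) unfolding curvature_g6[OF assms(1)] by auto
  ultimately show ?thesis by force
qed

lemma weight_metric_inv: "matrix_inv (g6 f p) $ i $ j \<noteq> 0 \<Longrightarrow> weight i + weight j \<le> 0"
  unfolding matrix_inv_g6 g6_inv_def vec_lambda_beta
  by (cases i; cases j) (simp_all add: weight_def)

abbreviation total_weight :: "coord list \<Rightarrow> int" where
  "total_weight is \<equiv> (\<Sum>i\<leftarrow>is. weight i)"

lemma total_weight_update: "s < length is \<Longrightarrow> total_weight (is[s := l]) = total_weight is - weight (is ! s) + weight l"
  by (induction "is" arbitrary: s) (auto split: nat.split simp: nth_Cons)

definition translation_invariant :: "'n \<Rightarrow> (real^'n::finite \<Rightarrow> real) \<Rightarrow> bool" where
  "translation_invariant i F \<longleftrightarrow> (\<forall>p t. F (p + t *\<^sub>R axis i 1) = F p)"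

lemma translation_invariant_partial:
  assumes "translation_invariant i F"
  shows "translation_invariant i (partial j F)" "partial i F p = 0"
proof -
  have "F (p + t *\<^sub>R axis i 1 + s *\<^sub>R axis j 1) = F (p + s *\<^sub>R axis j 1)" for p t s
    using assms unfolding translation_invariant_def by (metis add.assoc add.commute)
  then show "translation_invariant i (partial j F)"
    by (simp add: translation_invariant_def partial_def)
  show "partial i F p = 0"
    using assms by (simp add: translation_invariant_def partial_def)
qed

lemma translation_invariant_christoffel:
  assumes "smooth_real f"
  shows "translation_invariant Cxt (\<lambda>p. christoffel (g6 f) p i j k)"
proof -
  have "potential_grad f (p + t *\<^sub>R axis Cxt 1) i = potential_grad f p i" for p t i
    by (cases i) (simp_all add: potential_grad_def axis_def)
  then show ?thesis by (simp add: translation_invariant_def christoffel_g6[OF assms])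
qed

text \<open>A derivative in a direction other than \<open>x-tilde\<close> adds a nonnegative weight, and a Christoffel symbol
  \<open>\<Gamma>\<^sub>i\<^sub>j\<^sup>l\<close> does not increase the weight when it replaces \<open>i\<close>, \<open>j\<close> by \<open>l\<close>. The one direction that would lower the
  weight gives zero, since nothing depends on the coordinate \<open>x-tilde\<close>; this independence is
  carried through the same induction.\<close>

lemma weight_nabla_R:
  assumes f: "smooth_real f"
  shows "length is = 4 + k \<Longrightarrow> translation_invariant Cxt (\<lambda>p. nabla_R (g6 f) k p is) \<and>
    (total_weight is < 2 \<longrightarrow> (\<forall>p. nabla_R (g6 f) k p is = 0))"
proof (induction k arbitrary: "is")
  case 0
  then obtain i j l m where "is": "is = [i, j, l, m]"
    by (auto simp: length_Suc_conv numeral_eq_Suc)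
  have "potential_hess f (p + t *\<^sub>R axis Cxt 1) i j = potential_hess f p i j" for p t i j
    by (simp add: potential_hess_def axis_def)
  then have "translation_invariant Cxt (\<lambda>p. nabla_R (g6 f) 0 p is)"
    by (simp add: "is" translation_invariant_def curvature_g6[OF f])
  moreover have "nabla_R (g6 f) 0 p is = 0" if "total_weight is < 2" for p
    using weight_curvature[OF f, of p i j l m] that by (auto simp: "is" numeral_2_eq_2 numeral_3_eq_3)
  ultimately show ?case by blast
next
  case (Suc k)
  then obtain js j where "is": "is = js @ [j]" and len: "length js = 4 + k"
    by (metis add_Suc_right length_Suc_conv_rev)
  let ?T = "nabla_R (g6 f) k" and ?C = "christoffel (g6 f)"
  have eq: "nabla_R (g6 f) (Suc k) p is = partial j (\<lambda>q. ?T q js) p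
        - (\<Sum>s<length js. \<Sum>l\<in>UNIV. ?C p j (js ! s) l * ?T p (js[s := l]))" for p
    by (simp add: "is" cov_deriv_def)
  have inv: "translation_invariant Cxt (\<lambda>p. ?T p js)" "translation_invariant Cxt (\<lambda>p. ?T p (js[s := l]))" for s l
    using Suc.IH len by simp_all
  have "translation_invariant Cxt (\<lambda>p. nabla_R (g6 f) (Suc k) p is)"
    using translation_invariant_partial(1)[OF inv(1), of j] inv(2) translation_invariant_christoffel[OF f]
    unfolding eq translation_invariant_def by simp
  moreover have "nabla_R (g6 f) (Suc k) p is = 0" if w: "total_weight is < 2" for p
  proof -
    have "partial j (\<lambda>q. ?T q js) p = 0"
    proof (cases "j = Cxt")
      case True
      then show ?thesis using translation_invariant_partial(2)[OF inv(1)] by simp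
    next
      case False
      then have "weight j \<ge> 0" by (cases j) (simp_all add: weight_def)
      then have "?T q js = 0" for q using Suc.IH[of js] len w by (simp add: "is")
      then show ?thesis by (simp add: partial_def)
    qed
    moreover have "?C p j (js ! s) l * ?T p (js[s := l]) = 0" if s: "s < length js" for s l
    proof (rule ccontr)
      assume nz: "\<not> ?thesis"
      then have c: "weight l \<le> weight j + weight (js ! s)"
        using weight_christoffel[OF f, of p j "js ! s" l] by auto
      then have "total_weight (js[s := l]) < 2"
        using w by (simp add: total_weight_update[OF s] "is")
      then show False using Suc.IH[of "js[s := l]"] len nz by simp
    qed
    then have "(\<Sum>s<length js. \<Sum>l\<in>UNIV. ?C p j (js ! s) l * ?T p (js[s := l])) = 0"
      by (intro sum.neutral ballI) simp
    ultimately show ?thesis unfolding eq by simp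
  qed
  ultimately show ?case by blast
qed

lemma weight_curvature_product:
  assumes "smooth_real f"
  shows "length is = index_count ks \<Longrightarrow> curvature_product (g6 f) ks p is \<noteq> 0
    \<Longrightarrow> total_weight is \<ge> 2 * int (length ks)"
proof (induction ks arbitrary: "is")
  case (Cons k ks)
  have "total_weight (take (4 + k) is) \<ge> 2"
    using weight_nabla_R[OF assms, of "take (4 + k) is" k] Cons.prems by (force simp: index_count_def not_le)
  moreover have "total_weight (drop (4 + k) is) \<ge> 2 * int (length ks)"
    using Cons.prems by (intro Cons.IH) (auto simp: index_count_def)
  moreover have "total_weight is = total_weight (take (4 + k) is) + total_weight (drop (4 + k) is)"
    by (metis append_take_drop_id map_append sum_list.append)
  ultimately show ?case by simp
qed (simp add: index_count_def)

lemma sum_over_pairing: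
  fixes w :: "nat \<Rightarrow> int"
  assumes "pairing N \<sigma>"
  shows "(\<Sum>s<N. w s) = (\<Sum>s | s < N \<and> s < \<sigma> s. w s + w (\<sigma> s))"
proof -
  have \<sigma>: "\<sigma> s < N" "\<sigma> s \<noteq> s" "\<sigma> (\<sigma> s) = s" if "s < N" for s
    using assms that by (simp_all add: pairing_def)
  have split: "{..<N} = {s. s < N \<and> s < \<sigma> s} \<union> {s. s < N \<and> \<sigma> s < s}"
  proof (intro equalityI subsetI)
    fix s assume "s \<in> {..<N}"
    then show "s \<in> {s. s < N \<and> s < \<sigma> s} \<union> {s. s < N \<and> \<sigma> s < s}"
      using \<sigma>(2)[of s] by simp linarith
  qed auto
  have "(\<Sum>s<N. w s) = (\<Sum>s | s < N \<and> s < \<sigma> s. w s) + (\<Sum>s | s < N \<and> \<sigma> s < s. w s)"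
    unfolding split by (rule sum.union_disjoint) auto
  also have "(\<Sum>s | s < N \<and> \<sigma> s < s. w s) = (\<Sum>s | s < N \<and> s < \<sigma> s. w (\<sigma> s))"
    by (rule sum.reindex_bij_witness[of _ \<sigma> \<sigma>]) (simp_all add: \<sigma>)
  finally show ?thesis by (simp add: sum.distrib)
qed

text \<open>Summing weights over the pairs gives at most 0 if all inverse metric factors are nonzero, and summing them
  over the curvature factors gives at least \<open>2\<close> for each of these, so no term survives once there is a curvature
  factor.\<close>

lemma full_contraction_g6:
  assumes f: "smooth_real f" and \<sigma>: "pairing (index_count ks) \<sigma>"
  shows "full_contraction ks \<sigma> (g6 f) p = (if ks = [] then 1 else 0)"
proof (cases "ks = []")
  case True
  then show ?thesis by (simp add: full_contraction_def index_count_def)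
next
  case False
  let ?N = "index_count ks"
  have "(\<Prod>s | s < ?N \<and> s < \<sigma> s. matrix_inv (g6 f p) $ (is ! s) $ (is ! \<sigma> s)) * curvature_product (g6 f) ks p is = 0"
    if len: "length is = ?N" for "is"
  proof (rule ccontr)
    assume nz: "\<not> ?thesis"
    then have "\<forall>s\<in>{s. s < ?N \<and> s < \<sigma> s}. matrix_inv (g6 f p) $ (is ! s) $ (is ! \<sigma> s) \<noteq> 0"
      by (auto simp: prod_zero_iff)
    then have "(\<Sum>s | s < ?N \<and> s < \<sigma> s. weight (is ! s) + weight (is ! \<sigma> s)) \<le> 0"
      by (intro sum_nonpos) (blast intro: weight_metric_inv)
    moreover have "total_weight is = (\<Sum>s<?N. weight (is ! s))"
      using len by (simp add: sum_list_sum_nth atLeast0LessThan)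
    moreover have "total_weight is \<ge> 2 * int (length ks)"
      using weight_curvature_product[OF f len] nz by auto
    moreover have "length ks > 0" using False by simp
    ultimately show False using sum_over_pairing[OF \<sigma>, of "\<lambda>s. weight (is ! s)"] by linarith
  qed
  then have "full_contraction ks \<sigma> (g6 f) p = 0"
    unfolding full_contraction_def by (intro sum.neutral) blast
  then show ?thesis using False by simp
qed

lemma weyl_invariant_constant_g6:
  assumes "weyl_invariant W" "smooth_real f\<^sub>1" "smooth_real f\<^sub>2"
  shows "W (g6 f\<^sub>1) p = W (g6 f\<^sub>2) q"
  using assms(1)
  by (induction W rule: weyl_invariant.induct) (simp_all add: full_contraction_g6 assms(2,3))

lemma admissible_exp: "admissible exp"
proof -
  have d: "deriv exp = (exp :: real \<Rightarrow> real)" by (simp add: fun_eq_iff DERIV_imp_deriv)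
  have "(deriv ^^ k) exp = (exp :: real \<Rightarrow> real)" for k by (induction k) (simp_all add: d)
  moreover have "exp differentiable at (x::real)" for x
    using DERIV_exp real_differentiable_def by blast
  ultimately show ?thesis by (simp add: admissible_def smooth_real_def d)
qed

lemma alpha6_not_weyl:
  "\<nexists>W. weyl_invariant W \<and> (\<forall>f P. admissible f \<longrightarrow> alpha6 f P = W (g6 f) P)"
proof (rule notI, elim exE conjE)
  fix W assume W: "weyl_invariant W" and eq: "\<forall>f P. admissible f \<longrightarrow> alpha6 f P = W (g6 f) P"
  obtain P Q where "alpha6 exp P \<noteq> alpha6 exp Q" using alpha6_not_constant[OF admissible_exp] by blast
  moreover have "alpha6 exp P = alpha6 exp Q"
    using eq admissible_exp weyl_invariant_constant_g6[OF W, of exp exp P Q] by (simp add: admissible_def)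
  ultimately show False by blast
qed

section \<open>The family of plane waves and its invariant\<close>

theorem theorem3p2:
  shows
    "(\<forall>f. admissible f \<longrightarrow> generalized_plane_wave (g6 f) \<and> curvature_homogeneous 0 (g6 f)) \<and>
     (\<forall>f\<^sub>1 f\<^sub>2 P\<^sub>1 P\<^sub>2. admissible f\<^sub>1 \<and> admissible f\<^sub>2 \<and> models_isomorphic 1 (g6 f\<^sub>1) P\<^sub>1 (g6 f\<^sub>2) P\<^sub>2
        \<longrightarrow> alpha6 f\<^sub>1 P\<^sub>1 = alpha6 f\<^sub>2 P\<^sub>2) \<and>
     (\<forall>f\<^sub>1 f\<^sub>2 P\<^sub>1 P\<^sub>2 U V \<phi>. admissible f\<^sub>1 \<and> admissible f\<^sub>2 \<and>
        isometry_between (g6 f\<^sub>1) U (g6 f\<^sub>2) V \<phi> \<and> P\<^sub>1 \<in> U \<and> \<phi> P\<^sub>1 = P\<^sub>2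
        \<longrightarrow> alpha6 f\<^sub>1 P\<^sub>1 = alpha6 f\<^sub>2 P\<^sub>2) \<and>
     (\<nexists>W :: coord metric \<Rightarrow> real^coord \<Rightarrow> real. weyl_invariant W \<and>
        (\<forall>f P. admissible f \<longrightarrow> alpha6 f P = W (g6 f) P)) \<and>
     (\<forall>f. admissible f \<longrightarrow> \<not> curvature_homogeneous 1 (g6 f))"
proof (intro conjI allI impI)
  fix f assume "admissible f"
  then have f: "smooth_real f" by (simp add: admissible_def)
  show "generalized_plane_wave (g6 f)" by (rule generalized_plane_wave_g6[OF f])
  show "curvature_homogeneous 0 (g6 f)"
    unfolding curvature_homogeneous_def using models_isomorphic_0_g6[OF f f] by blast
next
  fix f\<^sub>1 f\<^sub>2 P\<^sub>1 P\<^sub>2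
  assume "admissible f\<^sub>1 \<and> admissible f\<^sub>2 \<and> models_isomorphic 1 (g6 f\<^sub>1) P\<^sub>1 (g6 f\<^sub>2) P\<^sub>2"
  then show "alpha6 f\<^sub>1 P\<^sub>1 = alpha6 f\<^sub>2 P\<^sub>2" using alpha6_model_invariant by blast
next
  fix f\<^sub>1 f\<^sub>2 P\<^sub>1 P\<^sub>2 U V \<phi>
  assume "admissible f\<^sub>1 \<and> admissible f\<^sub>2 \<and> isometry_between (g6 f\<^sub>1) U (g6 f\<^sub>2) V \<phi> \<and> P\<^sub>1 \<in> U \<and> \<phi> P\<^sub>1 = P\<^sub>2"
  then show "alpha6 f\<^sub>1 P\<^sub>1 = alpha6 f\<^sub>2 P\<^sub>2"
    using isometry_imp_models_isomorphic[of "g6 f\<^sub>1" "g6 f\<^sub>2" U V \<phi> P\<^sub>1 1] smooth_geometry_g6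
      alpha6_model_invariant[of f\<^sub>1 f\<^sub>2 P\<^sub>1 P\<^sub>2] by (auto simp: admissible_def)
next
  show "\<nexists>W. weyl_invariant W \<and> (\<forall>f P. admissible f \<longrightarrow> alpha6 f P = W (g6 f) P)"
    by (rule alpha6_not_weyl)
next
  fix f assume f: "admissible f"
  then show "\<not> curvature_homogeneous 1 (g6 f)"
    unfolding curvature_homogeneous_def
    using alpha6_not_constant[OF f] alpha6_model_invariant[OF f f] by blast
qed

end
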